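(* Let $L,M,N$ be positive integers with $M<L$, $r\in\{1,\ldots,L-1\}$, $q\geq0$ an integer, and let $k_0,k_1,\ldots,k_{2q+1}\in\mathbb Z$ satisfy $k_{2q+1}\leq k_{2q}<k_{2q-1}\leq\cdots\leq k_2<k_1\leq k_0$ and $$k_0+2-k_1+\sum_{j=1}^q(k_{2j}+1-k_{2j+1})\leq\min\{r,M,L-r\},$$ $$\max\{0,r-L+M\}\leq k_{2q+1}\leq k_0+1\leq\min\{M+N-1,r+N-1\}.$$ Let $\mathcal I=\sqcup_{j=0}^q([k_{2j+1},k_{2j}]\cap\mathbb Z)$ and let $\mathcal I^*=\mathcal I\cup\{k_0+1\}$ be the set obtained by replacing $k_0$ by $k_0+1$. Let $q_{M-1}$ and $p_{N-1}$ be polynomials of degrees at most $M-1$ and $N-1$, respectively, such that $$\frac{q_{M-1}(z)}{z^{M+N}}+\frac{(1+z)^L}{z^{M+N}}p_{N-1}(z)-\frac{(1+z)^{L-r}}{z^{M+N}}\left(z^{k_0+1}+\sum_{j=0}^q\left[(1+z)^rp_{N-1}(z)\right]_{k_{2j+1}}^{k_{2j}}\right)=O(1),\qquad z\to0.$$ Then $$\frac{G_{L,M,N}^{r,\mathcal I^*}}{G_{L,M,N}^{r,\mathcal I}}=1-\alpha_{k_0+1},\qquad\alpha_{k_0+1}:=\frac1{(k_0+1)!}\frac{d^{k_0+1}}{dz^{k_0+1}}\left((1+z)^rp_{N-1}(z)\right)\Big|_{z=0}.$$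
   Context: For a polynomial $P(z)=\sum_l\alpha_lz^l$ and integers $0\leq n_1\leq n_2$, $[P(z)]_{n_1}^{n_2}:=\sum_{l=n_1}^{n_2}\alpha_lz^l$. The hexagon $H_{L,M,N}$ is the hexagon in $\mathbb R^2$ with corners $(0,0)$, $(L-M,0)$, $(L,M)$, $(L,M+N)$, $(M,M+N)$, $(0,N)$. Lozenges are the translates, by vectors of $\mathbb Z^2$, of the three parallelograms with vertices $(0,0),(0,1),(1,2),(1,1)$; $(0,0),(0,1),(1,1),(1,0)$; $(0,0),(1,1),(2,1),(1,0)$. A lozenge tiling of a region is a collection of lozenges contained in (the closure of) the region, with disjoint interiors, whose union is (the closure of) the region. The reduced hexagon $H_{L,M,N}^{r,\mathcal I}$ is the intersection of $H_{L,M,N}$ with the complement of the following $q+1$ large lozenges: for $j=0,\ldots,q$, with $s_j=k_{2j}-k_{2j+1}+1$, the lozenge with corners $(r-s_j,k_{2j+1})$, $(r,k_{2j+1})$, $(r+s_j,k_{2j}+1)$, $(r,k_{2j}+1)$. $G_{L,M,N}^{r,\mathcal I}$ is the number of lozenge tilings of $H_{L,M,N}^{r,\mathcal I}$, and $G_{L,M,N}^{r,\mathcal I^*}$ is defined in the same way with $k_0$ replaced by $k_0+1$. Equivalently: draw on each lozenge of the first two types the segment joining the midpoints of its two vertical sides, and shift vertical coordinates by $y\mapsto y-\frac12$; a tiling of $H_{L,M,N}$ then gives $N$ non-intersecting paths from $(0,0),\ldots,(0,N-1)$ to $(L,M),\ldots,(L,M+N-1)$, and $G_{L,M,N}^{r,\mathcal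 I}$ is the number of tilings of $H_{L,M,N}$ whose paths contain no point of $\{r\}\times\mathcal I$. *)

theory Defs
  imports "HOL-Analysis.Analysis" "HOL-Library.Landau_Symbols"
begin

definition poly_slice :: "'a::comm_monoid_add poly \<Rightarrow> nat \<Rightarrow> nat \<Rightarrow> 'a poly" where
  "poly_slice P n1 n2 = (\<Sum>l=n1..n2. monom (coeff P l) l)"

definition hexagon :: "nat \<Rightarrow> nat \<Rightarrow> nat \<Rightarrow> (real \<times> real) set" where
  "hexagon L M N = convex hull
     {(0, 0), (real L - real M, 0), (real L, real M), (real L, real M + real N),
      (real M, real M + real N), (0, real N)}"

definition basic_lozenges :: "(real \<times> real) set set" where
  "basic_lozenges =
     {convex hull {(0, 0), (0, 1), (1, 2), (1, 1)},
      convex hull {(0, 0), (0, 1), (1, 1), (1, 0)},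
      convex hull {(0, 0), (1, 1), (2, 1), (1, 0)}}"

definition lozenges :: "(real \<times> real) set set" where
  "lozenges = {(\<lambda>x. (real_of_int a, real_of_int b) + x) ` B | a b B. B \<in> basic_lozenges}"

definition is_lozenge_tiling :: "(real \<times> real) set \<Rightarrow> (real \<times> real) set set \<Rightarrow> bool" where
  "is_lozenge_tiling R T \<longleftrightarrow>
     T \<subseteq> lozenges \<and>
     (\<forall>A\<in>T. A \<subseteq> closure R) \<and>
     pairwise (\<lambda>A B. interior A \<inter> interior B = {}) T \<and>
     \<Union>T = closure R"

definition large_lozenge :: "nat \<Rightarrow> int \<Rightarrow> int \<Rightarrow> (real \<times> real) set" where
  "large_lozenge r a b = (let s = real_of_int (b - a + 1) in convex hull
     {(real r - s, real_of_int a), (real r, real_of_int a),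
      (real r + s, real_of_int b + 1), (real r, real_of_int b + 1)})"

(* The set \<I> is the disjoint union of the integer intervals [k (2 j + 1), k (2 j)], j = 0..q,
   and is represented by q and k. The removed lozenges are closed, so that removing one that
   touches the boundary of the hexagon leaves no isolated boundary pieces behind. *)
definition reduced_hexagon ::
    "nat \<Rightarrow> nat \<Rightarrow> nat \<Rightarrow> nat \<Rightarrow> nat \<Rightarrow> (nat \<Rightarrow> int) \<Rightarrow> (real \<times> real) set" where
  "reduced_hexagon L M N r q k =
     hexagon L M N - (\<Union>j\<in>{0..q}. large_lozenge r (k (2 * j + 1)) (k (2 * j)))"

definition G :: "nat \<Rightarrow> nat \<Rightarrow> nat \<Rightarrow> nat \<Rightarrow> nat \<Rightarrow> (nat \<Rightarrow> int) \<Rightarrow> nat" where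
  "G L M N r q k = card {T. is_lozenge_tiling (reduced_hexagon L M N r q k) T}"

end

(* A tiling is the same as a family of N non-intersecting lattice paths. Let x_a(m) be the vector whose
   i-th entry counts the single paths from (0,i) to (a,m) that avoid the holes in column r. By multilinearity
   of the determinant, Pascal's recursion x_{a+1}(m) = x_a(m) + x_a(m-1) lifts to a recursion for
   det (x_a(t_0), ..., x_a(t_{N-1})) with t_0 < t_1 < ..., which is the recursion for the number of path
   families ending at the t_j, since non-injective choices produce two equal rows. Hence G is the determinant
   of a matrix A whose entries are coefficients of (1+z)^(L-r) times a truncation of (1+z)^r z^i.

   The extra hole at k_0+1 subtracts from A a rank-one matrix u v^T, and the condition on p and q says exactly
   that u = A p, so the determinant gets multiplied by 1 - v.p = 1 - alpha.

   If column r has at least N free places, then a path family exists and one may divide. Otherwise G = 0 and the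
   quotient is 0 by convention. Then the equation A p = u, together with the linear independence of the relevant
   vectors of binomial coefficients (again a positive count of path families), forces alpha = 1. *)

theory Submission
  imports Defs "Jordan_Normal_Form.Determinant"
begin

section \<open>Determinants that count families of lattice paths\<close>

text \<open>No sign-reversing involution and no bijection of whole path systems is needed.
  Determinant, path families and tilings are each peeled off column by column from the right, with
  an arbitrary increasing right boundary \<open>t\<close>, and all three satisfy the same recursion:
  a sum over the sets of paths that rise in the last step.

  The geometric obstacle is that tilings consist of closed regions that share boundary points. Only
  points of open unit triangles are therefore tested. There \<open>x\<close>, \<open>y\<close> and
  \<open>y - x\<close> lie strictly between consecutive integers, so that hexagon, holes and
  lozenges all become sets of integer pairs.

  The algebraic obstacle is that the matrix may be singular. The update formula is therefore a
  product of matrices and never inverts one.\<close>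

definition lower :: "nat set \<Rightarrow> (nat \<Rightarrow> int) \<Rightarrow> nat \<Rightarrow> int" where
  "lower E t j = t j - of_bool (j \<in> E)"

lemma det_mat_perm:
  "Determinant.det (Matrix.mat N N (\<lambda>(j, i). A j i)) =
    (\<Sum>p\<in>{p. p permutes {0..<N}}. signof p * (\<Prod>j=0..<N. (A j (p j) :: 'a::comm_ring_1)))"
proof -
  have "Determinant.det (Matrix.mat N N (\<lambda>(j, i). A j i)) =
    (\<Sum>p\<in>{p. p permutes {0..<N}}. signof p * (\<Prod>j=0..<N. (Matrix.mat N N (\<lambda>(j, i). A j i)) $$ (j, p j)))"
    by (rule det_def') auto
  also have "\<dots> = (\<Sum>p\<in>{p. p permutes {0..<N}}. signof p * (\<Prod>j=0..<N. A j (p j)))"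
    by (intro sum.cong refl arg_cong2[where f="(*)"] prod.cong)
       (auto simp: permutes_in_image)
  finally show ?thesis .
qed

text \<open>Multilinearity, read off the Leibniz formula: in a product over the rows, the set
  \<open>E\<close> of rows that contribute \<open>y\<close> is chosen freely.\<close>

lemma det_rows_add_expand:
  fixes x y :: "nat \<Rightarrow> nat \<Rightarrow> 'a::comm_ring_1"
  shows "Determinant.det (Matrix.mat N N (\<lambda>(j, i). y j i + x j i)) =
    (\<Sum>E\<in>Pow {0..<N}. Determinant.det (Matrix.mat N N (\<lambda>(j, i). if j \<in> E then y j i else x j i)))"
proof -
  have *: "(\<Prod>j=0..<N. y j (p j) + x j (p j)) =
      (\<Sum>E\<in>Pow {0..<N}. \<Prod>j=0..<N. if j \<in> E then y j (p j) else x j (p j))" for p :: "nat \<Rightarrow> nat"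
  proof -
    have "(\<Prod>j=0..<N. y j (p j) + x j (p j)) =
      (\<Sum>E\<in>Pow {0..<N}. (\<Prod>j\<in>E. y j (p j)) * (\<Prod>j\<in>{0..<N} - E. x j (p j)))"
      by (rule prod_add) auto
    also have "\<dots> = (\<Sum>E\<in>Pow {0..<N}. \<Prod>j=0..<N. if j \<in> E then y j (p j) else x j (p j))"
    proof (rule sum.cong[OF refl])
      fix E assume "E \<in> Pow {0..<N}"
      then have E: "E \<subseteq> {0..<N}" by auto
      have "(\<Prod>j=0..<N. if j \<in> E then y j (p j) else x j (p j)) =
        (\<Prod>j\<in>{0..<N} - E. if j \<in> E then y j (p j) else x j (p j)) * (\<Prod>j\<in>E. if j \<in> E then y j (p j) else x j (p j))"
        by (rule prod.subset_diff[OF E]) auto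
      also have "\<dots> = (\<Prod>j\<in>{0..<N} - E. x j (p j)) * (\<Prod>j\<in>E. y j (p j))"
        by (intro arg_cong2[where f="(*)"] prod.cong) auto
      finally show "(\<Prod>j\<in>E. y j (p j)) * (\<Prod>j\<in>{0..<N} - E. x j (p j)) =
        (\<Prod>j=0..<N. if j \<in> E then y j (p j) else x j (p j))" by (simp add: mult.commute)
    qed
    finally show ?thesis .
  qed
  have "Determinant.det (Matrix.mat N N (\<lambda>(j, i). y j i + x j i)) =
    (\<Sum>p\<in>{p. p permutes {0..<N}}. \<Sum>E\<in>Pow {0..<N}. signof p * (\<Prod>j=0..<N. if j \<in> E then y j (p j) else x j (p j)))"
    unfolding det_mat_perm * sum_distrib_left ..
  also have "\<dots> = (\<Sum>E\<in>Pow {0..<N}. \<Sum>p\<in>{p. p permutes {0..<N}}. signof p * (\<Prod>j=0..<N. if j \<in> E then y j (p j) else x j (p j)))"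
    by (rule sum.swap)
  finally show ?thesis unfolding det_mat_perm .
qed

lemma det_row_zero:
  fixes A :: "nat \<Rightarrow> nat \<Rightarrow> 'a::comm_ring_1"
  assumes "j < N" "\<And>i. i < N \<Longrightarrow> A j i = 0"
  shows "Determinant.det (Matrix.mat N N (\<lambda>(j, i). A j i)) = 0"
  unfolding det_mat_perm
proof (rule sum.neutral, rule ballI)
  fix p assume "p \<in> {p. p permutes {0..<N}}"
  then have "p j < N" using assms(1) by (auto simp: permutes_in_image)
  then have "(\<Prod>j=0..<N. A j (p j)) = 0"
    using assms by (intro prod_zero bexI[of _ j]) auto
  then show "signof p * (\<Prod>j=0..<N. A j (p j)) = 0" by simp
qed

lemma det_equal_rows:
  fixes A :: "nat \<Rightarrow> nat \<Rightarrow> 'a::comm_ring_1"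
  assumes "j < N" "j' < N" "j \<noteq> j'" "\<And>i. i < N \<Longrightarrow> A j i = A j' i"
  shows "Determinant.det (Matrix.mat N N (\<lambda>(j, i). A j i)) = 0"
  by (rule det_identical_rows[of _ N j j']) (use assms in \<open>auto intro!: eq_vecI\<close>)

text \<open>Distinct integers differ by at least 1 and each is lowered by at most 1, so two values
  may collide but never change order. Non-crossing thus amounts to injectivity, which is what a
  determinant detects.\<close>

lemma lower_strict_mono:
  assumes "strict_mono_on {0..<N} t" "inj_on (lower E t) {0..<N}"
  shows "strict_mono_on {0..<N} (lower E t)"
proof (rule strict_mono_onI)
  fix i j assume ij: "i \<in> {0..<N}" "j \<in> {0..<N}" "i < j"
  then have "t i < t j" using assms(1) by (auto simp: strict_mono_on_def)
  then have "lower E t i \<le> lower E t j" by (auto simp: lower_def)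
  moreover have "lower E t i \<noteq> lower E t j" using inj_onD[OF assms(2), of i j] ij by auto
  ultimately show "lower E t i < lower E t j" by simp
qed

text \<open>Besides the collisions, the forbidden places have to drop out of the expansion: an
  endpoint outside \<open>Y\<close> makes a whole row zero.\<close>

lemma det_pascal_step:
  fixes g :: "int \<Rightarrow> nat \<Rightarrow> 'a::comm_ring_1"
  assumes t: "strict_mono_on {0..<N} t"
    and g: "\<And>m i. m \<notin> Y \<Longrightarrow> g m i = 0"
  shows "Determinant.det (Matrix.mat N N (\<lambda>(j, i). g (t j) i + g (t j - 1) i)) =
    (\<Sum>E | E \<subseteq> {0..<N} \<and> strict_mono_on {0..<N} (lower E t) \<and> lower E t ` {0..<N} \<subseteq> Y.
       Determinant.det (Matrix.mat N N (\<lambda>(j, i). g (lower E t j) i)))"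
proof -
  have "Determinant.det (Matrix.mat N N (\<lambda>(j, i). g (t j) i + g (t j - 1) i)) =
    Determinant.det (Matrix.mat N N (\<lambda>(j, i). g (t j - 1) i + g (t j) i))"
    by (simp add: add.commute)
  also have "\<dots> = (\<Sum>E\<in>Pow {0..<N}. Determinant.det (Matrix.mat N N (\<lambda>(j, i). if j \<in> E then g (t j - 1) i else g (t j) i)))"
    by (rule det_rows_add_expand)
  also have "\<dots> = (\<Sum>E\<in>Pow {0..<N}. Determinant.det (Matrix.mat N N (\<lambda>(j, i). g (lower E t j) i)))"
    by (intro sum.cong refl arg_cong[where f=Determinant.det] eq_matI) (auto simp: lower_def)
  also have "\<dots> = (\<Sum>E | E \<subseteq> {0..<N} \<and> strict_mono_on {0..<N} (lower E t) \<and> lower E t ` {0..<N} \<subseteq> Y.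
       Determinant.det (Matrix.mat N N (\<lambda>(j, i). g (lower E t j) i)))"
  proof (rule sum.mono_neutral_right, goal_cases)
    case 3
    show ?case
    proof
      fix E assume E: "E \<in> Pow {0..<N} - {E. E \<subseteq> {0..<N} \<and> strict_mono_on {0..<N} (lower E t) \<and> lower E t ` {0..<N} \<subseteq> Y}"
      show "Determinant.det (Matrix.mat N N (\<lambda>(j, i). g (lower E t j) i)) = 0"
      proof (cases "strict_mono_on {0..<N} (lower E t)")
        case True
        then have "\<not> lower E t ` {0..<N} \<subseteq> Y" using E by simp
        then obtain j where "j \<in> {0..<N}" "lower E t j \<notin> Y" by blast
        then show ?thesis using g by (intro det_row_zero[of j]) auto
      next
        case False
        then have "\<not> inj_on (lower E t) {0..<N}" using lower_strict_mono[OF t] by blast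
        then obtain j j' where "j < N" "j' < N" "j \<noteq> j'" "lower E t j = lower E t j'"
          by (fastforce simp: inj_on_def)
        then show ?thesis by (intro det_equal_rows[of j _ j']) auto
      qed
    qed
  qed auto
  finally show ?thesis .
qed

text \<open>The number of paths from \<open>(0, s i)\<close> to \<open>(n, m)\<close>. A column is
  tested against \<open>Y\<close> when it is left, so column \<open>n\<close> itself is
  unconstrained and its heights can be prescribed freely as a right boundary.\<close>

primrec path_count :: "(int \<Rightarrow> int set) \<Rightarrow> (nat \<Rightarrow> int) \<Rightarrow> nat \<Rightarrow> int \<Rightarrow> nat \<Rightarrow> 'a::comm_ring_1" where
  "path_count Y s 0 = (\<lambda>m i. of_bool (m = s i))"
| "path_count Y s (Suc n) = (\<lambda>m i. of_bool (m \<in> Y (int n)) * path_count Y s n m i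
     + of_bool (m - 1 \<in> Y (int n)) * path_count Y s n (m - 1) i)"

text \<open>\<open>E\<close> is the set of paths that rise in the last step before the boundary
  \<open>t\<close>.\<close>

definition downsteps :: "nat \<Rightarrow> int set \<Rightarrow> (nat \<Rightarrow> int) \<Rightarrow> nat set set" where
  "downsteps N Y t = {E. E \<subseteq> {0..<N} \<and> strict_mono_on {0..<N} (lower E t) \<and> lower E t ` {0..<N} \<subseteq> Y}"

primrec path_families :: "nat \<Rightarrow> (int \<Rightarrow> int set) \<Rightarrow> (nat \<Rightarrow> int) \<Rightarrow> nat \<Rightarrow> (nat \<Rightarrow> int) \<Rightarrow> nat" where
  "path_families N Y s 0 t = of_bool (\<forall>j<N. t j = s j)"
| "path_families N Y s (Suc n) t = (\<Sum>E\<in>downsteps N (Y (int n)) t. path_families N Y s n (lower E t))"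

lemma finite_downsteps [simp]: "finite (downsteps N Y t)"
  by (rule finite_subset[of _ "Pow {0..<N}"]) (auto simp: downsteps_def)

text \<open>An increasing family is the sorted list of its values, and an inclusion between two sets
  of \<open>N\<close> values is an equality.\<close>

lemma strict_mono_on_image_unique:
  fixes s t :: "nat \<Rightarrow> int"
  assumes "strict_mono_on {0..<N} s" "strict_mono_on {0..<N} t" "t ` {0..<N} \<subseteq> s ` {0..<N}" "j < N"
  shows "t j = s j"
proof -
  have sd: "sorted (map u [0..<N]) \<and> distinct (map u [0..<N])" if "strict_mono_on {0..<N} u" for u :: "nat \<Rightarrow> int"
    using that by (auto simp: sorted_iff_nth_mono_less distinct_map strict_mono_on_imp_inj_on strict_mono_on_def intro!: less_imp_le)
  have "card (t ` {0..<N}) = card (s ` {0..<N})"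
    using assms by (simp add: card_image strict_mono_on_imp_inj_on)
  then have "t ` {0..<N} = s ` {0..<N}"
    using assms(3) by (intro card_subset_eq) auto
  then have "map t [0..<N] = map s [0..<N]"
    using sd[OF assms(1)] sd[OF assms(2)] by (intro sorted_distinct_set_unique) auto
  then show ?thesis using assms(4) by simp
qed

lemma det_path_count_eq_path_families:
  assumes s: "strict_mono_on {0..<N} s" and t: "strict_mono_on {0..<N} t"
  shows "Determinant.det (Matrix.mat N N (\<lambda>(j, i). path_count Y s n (t j) i :: 'a::comm_ring_1)) =
    of_nat (path_families N Y s n t)"
  using t
proof (induction n arbitrary: t)
  case 0
  show ?case
  proof (cases "\<forall>j<N. t j = s j")
    case True
    have "Matrix.mat N N (\<lambda>(j, i). path_count Y s 0 (t j) i :: 'a) = 1\<^sub>m N"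
      using True strict_mono_on_imp_inj_on[OF s] by (intro eq_matI) (auto simp: inj_on_def)
    then show ?thesis using True by simp
  next
    case False
    then have "\<not> t ` {0..<N} \<subseteq> s ` {0..<N}"
      using strict_mono_on_image_unique[OF s 0] by blast
    then obtain j where "j < N" "\<forall>i<N. t j \<noteq> s i" by fastforce
    then have "Determinant.det (Matrix.mat N N (\<lambda>(j, i). path_count Y s 0 (t j) i :: 'a)) = 0"
      by (intro det_row_zero[of j]) auto
    then show ?thesis using False by auto
  qed
next
  case (Suc n)
  define g :: "int \<Rightarrow> nat \<Rightarrow> 'a" where "g m i = of_bool (m \<in> Y (int n)) * path_count Y s n m i" for m i
  have "Determinant.det (Matrix.mat N N (\<lambda>(j, i). path_count Y s (Suc n) (t j) i :: 'a)) =
    Determinant.det (Matrix.mat N N (\<lambda>(j, i). g (t j) i + g (t j - 1) i))"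
    by (simp add: g_def)
  also have "\<dots> = (\<Sum>E\<in>downsteps N (Y (int n)) t. Determinant.det (Matrix.mat N N (\<lambda>(j, i). g (lower E t j) i)))"
    unfolding downsteps_def by (rule det_pascal_step[OF Suc.prems]) (simp add: g_def)
  also have "\<dots> = (\<Sum>E\<in>downsteps N (Y (int n)) t. of_nat (path_families N Y s n (lower E t)))"
  proof (rule sum.cong[OF refl])
    fix E assume E: "E \<in> downsteps N (Y (int n)) t"
    have "Matrix.mat N N (\<lambda>(j, i). g (lower E t j) i) = Matrix.mat N N (\<lambda>(j, i). path_count Y s n (lower E t j) i)"
      using E by (intro eq_matI) (auto simp: g_def downsteps_def image_subset_iff)
    then show "Determinant.det (Matrix.mat N N (\<lambda>(j, i). g (lower E t j) i)) = of_nat (path_families N Y s n (lower E t))"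
      using E Suc.IH by (simp add: downsteps_def)
  qed
  finally show ?case by simp
qed

text \<open>All terms of the recursion are natural numbers, so one explicit family is enough;
  \<open>x m j\<close> is the height of path \<open>j\<close> in column \<open>m\<close>.\<close>

lemma path_families_pos:
  assumes x0: "\<And>j. j < N \<Longrightarrow> x 0 j = s j"
    and step: "\<And>m j. m < n \<Longrightarrow> j < N \<Longrightarrow> x (Suc m) j - x m j \<in> {0, 1}"
    and Y: "\<And>m j. m < n \<Longrightarrow> j < N \<Longrightarrow> x m j \<in> Y (int m)"
    and mono: "\<And>m. m \<le> n \<Longrightarrow> strict_mono_on {0..<N} (x m)"
    and t: "\<And>j. j < N \<Longrightarrow> t j = x n j"
  shows "0 < path_families N Y s n t"
  using step Y mono t
proof (induction n arbitrary: t)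
  case 0
  then show ?case using x0 by simp
next
  case (Suc n)
  define E where "E = {j. j < N \<and> x (Suc n) j - x n j = 1}"
  have low: "lower E t j = x n j" if "j < N" for j
    using Suc.prems(1)[of n j] Suc.prems(4)[of j] that by (auto simp: lower_def E_def)
  have "strict_mono_on {0..<N} (lower E t)"
    using Suc.prems(3)[of n] low by (auto simp: strict_mono_on_def)
  then have E: "E \<in> downsteps N (Y (int n)) t"
    using low Suc.prems(2)[of n] by (auto simp: downsteps_def E_def)
  have "0 < path_families N Y s n (lower E t)"
    using low Suc.prems by (intro Suc.IH) auto
  also have "\<dots> \<le> path_families N Y s (Suc n) t"
    using E by (auto intro: member_le_sum)
  finally show ?case .
qed

section \<open>Combinatorial tilings as families of lattice paths\<close>

text \<open>A pair \<^term>\<open>(a, b)\<close> stands for the vertical unit segment from \<^term>\<open>(a, b)\<close> to \<^term>\<open>(a, b + 1)\<close>.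
  The lozenge made of the triangle to the right of \<open>e\<close> and the triangle to the left of \<open>e'\<close> is encoded
  as the arrow \<^term>\<open>(e, e')\<close>. Arrows with \<open>e = e'\<close> are the lozenges without a path step, the others
  are the path steps. A tiling is thus a bijection from the right to the left triangles of a region.\<close>

definition arrows :: "((int \<times> int) \<times> (int \<times> int)) set" where
  "arrows = {((a, b), (a', b')) | a b a' b'. (a' = a \<and> b' = b) \<or> (a' = a + 1 \<and> (b' = b \<or> b' = b + 1))}"

definition matchings :: "(int \<times> int) set \<Rightarrow> (int \<times> int) set \<Rightarrow> ((int \<times> int) \<times> (int \<times> int)) set set" where
  "matchings U W = {C. C \<subseteq> arrows \<inter> U \<times> W \<and> (\<forall>e\<in>U. \<exists>!e'. (e, e') \<in> C) \<and> (\<forall>e'\<in>W. \<exists>!e. (e, e') \<in> C)}"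

definition srcs :: "(int \<Rightarrow> int set) \<Rightarrow> nat \<Rightarrow> (int \<times> int) set" where
  "srcs Y n = {(a, b). 0 \<le> a \<and> a < int n \<and> b \<in> Y a}"

text \<open>Left triangles of column 0 stick out of the hexagon, so the columns start at 1. In
  column \<open>n\<close> only the places \<open>T\<close> met by a path count: the left triangles
  at the other places belong to lozenges of the next strip.\<close>

definition tgts :: "(int \<Rightarrow> int set) \<Rightarrow> nat \<Rightarrow> int set \<Rightarrow> (int \<times> int) set" where
  "tgts Y n T = {(a, b). 1 \<le> a \<and> a < int n \<and> b \<in> Y a} \<union> {int n} \<times> T"

text \<open>The tilings of the part of the region to the left of column \<open>n\<close>, with right boundary \<open>t\<close>.
  For \<open>n = 0\<close> this part is empty, and the boundary is compared with the first column instead.\<close>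

definition partial_tilings :: "nat \<Rightarrow> (int \<Rightarrow> int set) \<Rightarrow> nat \<Rightarrow> (nat \<Rightarrow> int) \<Rightarrow> ((int \<times> int) \<times> (int \<times> int)) set set" where
  "partial_tilings N Y n t =
    (if n = 0 then {C. C = {} \<and> t ` {0..<N} = Y 0} else matchings (srcs Y n) (tgts Y n (t ` {0..<N})))"

text \<open>The lozenges whose right triangle hangs at column \<open>n\<close>: a place met by a
  path carries its next step, any other place a lozenge without path step.\<close>

definition last_strip :: "nat \<Rightarrow> int set \<Rightarrow> int \<Rightarrow> (nat \<Rightarrow> int) \<Rightarrow> nat set \<Rightarrow> ((int \<times> int) \<times> (int \<times> int)) set" where
  "last_strip N Y n t E = {((n, b), (n, b)) | b. b \<in> Y - lower E t ` {0..<N}}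
     \<union> {((n, lower E t j), (n + 1, t j)) | j. j < N}"

lemma partial_tilings_sub: "C \<in> partial_tilings N Y n t \<Longrightarrow> C \<subseteq> arrows \<inter> srcs Y n \<times> tgts Y n (t ` {0..<N})"
  by (auto simp: partial_tilings_def matchings_def split: if_splits)

lemma partial_tilings_src: "C \<in> partial_tilings N Y n t \<Longrightarrow> e \<in> srcs Y n \<Longrightarrow> \<exists>!e'. (e, e') \<in> C"
  by (cases "n = 0") (auto simp: partial_tilings_def matchings_def srcs_def[of _ 0])

lemma partial_tilings_tgt: "C \<in> partial_tilings N Y n t \<Longrightarrow> 0 < n \<Longrightarrow> e \<in> tgts Y n (t ` {0..<N}) \<Longrightarrow> \<exists>!e'. (e', e) \<in> C"
  by (simp add: partial_tilings_def matchings_def)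

lemma partial_tilings_extend:
  assumes t: "strict_mono_on {0..<N} t"
    and E: "E \<in> downsteps N (Y (int n)) t" and C: "C \<in> partial_tilings N Y n (lower E t)"
  shows "C \<union> last_strip N (Y (int n)) (int n) t E \<in> partial_tilings N Y (Suc n) t"
proof -
  let ?D = "last_strip N (Y (int n)) (int n) t E"
  have lmono: "strict_mono_on {0..<N} (lower E t)" and lY: "lower E t ` {0..<N} \<subseteq> Y (int n)"
    using E by (auto simp: downsteps_def)
  have tinj: "t i = t j \<longleftrightarrow> i = j" if "i < N" "j < N" for i j
    using strict_mono_on_imp_inj_on[OF t] that by (auto simp: inj_on_def)
  have linj: "lower E t i = lower E t j \<longleftrightarrow> i = j" if "i < N" "j < N" for i j
    using strict_mono_on_imp_inj_on[OF lmono] that by (auto simp: inj_on_def)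
  have Cs: "a < int n" "0 \<le> a" "b \<in> Y a" "((a, b), (a', b')) \<in> arrows" "(a', b') \<in> tgts Y n (lower E t ` {0..<N})"
    if "((a, b), (a', b')) \<in> C" for a b a' b'
    using partial_tilings_sub[OF C] that by (auto simp: srcs_def)
  have D: "((a, b), (a', b')) \<in> ?D \<longleftrightarrow> a = int n \<and> ((a' = int n \<and> b' = b \<and> b \<in> Y (int n) - lower E t ` {0..<N})
      \<or> (a' = int n + 1 \<and> (\<exists>j<N. b = lower E t j \<and> b' = t j)))" for a b a' b'
    by (auto simp: last_strip_def)
  have "?D \<subseteq> arrows" by (auto simp: last_strip_def arrows_def lower_def)
  then have 1: "C \<union> ?D \<subseteq> arrows" using partial_tilings_sub[OF C] by auto
  have 2: "C \<union> ?D \<subseteq> srcs Y (Suc n) \<times> tgts Y (Suc n) (t ` {0..<N})"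
  proof (rule subsetI)
    fix c assume c: "c \<in> C \<union> ?D"
    obtain a b a' b' where cc: "c = ((a, b), (a', b'))" by (metis prod.collapse)
    show "c \<in> srcs Y (Suc n) \<times> tgts Y (Suc n) (t ` {0..<N})"
    proof (cases "c \<in> C")
      case True
      then show ?thesis using Cs[of a b a' b'] lY C by (cases "n = 0") (auto simp: cc srcs_def tgts_def partial_tilings_def)
    next
      case False
      then have d: "a = int n \<and> ((a' = int n \<and> b' = b \<and> b \<in> Y (int n) - lower E t ` {0..<N})
          \<or> (a' = int n + 1 \<and> (\<exists>j<N. b = lower E t j \<and> b' = t j)))"
        using c unfolding cc by (simp add: D)
      \<comment> \<open>A lozenge without path step cannot sit in column 0, which has no left
        triangles. This is why the case \<open>n = 0\<close> demands that all of \<open>Y 0\<close>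
        be occupied.\<close>
      have "n = 0 \<Longrightarrow> lower E t ` {0..<N} = Y 0" using C by (simp add: partial_tilings_def split: if_splits)
      then show ?thesis using d lY unfolding cc
        by (cases "n = 0") (auto simp: srcs_def tgts_def)
    qed
  qed
  have 3: "\<exists>!e'. (e, e') \<in> C \<union> ?D" if e: "e \<in> srcs Y (Suc n)" for e
  proof -
    obtain a b where ab: "e = (a, b)" by (cases e)
    show ?thesis
    proof (cases "a < int n")
      case True
      then have "e \<in> srcs Y n" using e ab by (auto simp: srcs_def)
      from partial_tilings_src[OF C this] show ?thesis using True ab D by auto
    next
      case False
      then have "a = int n" using e ab by (auto simp: srcs_def)
      then have a: "a = int n" "b \<in> Y (int n)" using e ab by (auto simp: srcs_def)
      then have nC: "(e, e') \<notin> C" for e' using Cs(1)[of a b "fst e'" "snd e'"] ab by auto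
      show ?thesis
      proof (cases "b \<in> lower E t ` {0..<N}")
        case True
        then obtain j where j: "j < N" "b = lower E t j" by auto
        show ?thesis
          by (rule ex1I[of _ "(int n + 1, t j)"]) (use nC j a ab in \<open>auto simp: D linj\<close>)
      next
        case False
        show ?thesis
          by (rule ex1I[of _ "(int n, b)"]) (use nC a ab False in \<open>auto simp: D\<close>)
      qed
    qed
  qed
  have 4: "\<exists>!e. (e, e') \<in> C \<union> ?D" if e': "e' \<in> tgts Y (Suc n) (t ` {0..<N})" for e'
  proof -
    obtain a b where ab: "e' = (a, b)" by (cases e')
    consider "a = int n + 1" "b \<in> t ` {0..<N}" | "1 \<le> a" "a = int n" "b \<in> Y a" "b \<notin> lower E t ` {0..<N}"
      | "0 < n" "e' \<in> tgts Y n (lower E t ` {0..<N})" "a \<le> int n" "a = int n \<longrightarrow> b \<in> lower E t ` {0..<N}"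
      using e' ab by (fastforce simp: tgts_def)
    then show ?thesis
    proof cases
      case 1
      then obtain j where j: "j < N" "b = t j" by auto
      have nC: "(e, e') \<notin> C" for e
        using Cs(5)[of "fst e" "snd e" a b] 1 ab by (auto simp: tgts_def)
      show ?thesis
        by (rule ex1I[of _ "(int n, lower E t j)"]) (use nC j 1 ab in \<open>auto simp: D tinj\<close>)
    next
      case 2
      have nC: "(e, e') \<notin> C" for e
        using Cs(5)[of "fst e" "snd e" a b] 2 ab by (auto simp: tgts_def)
      show ?thesis
        by (rule ex1I[of _ "(int n, b)"]) (use nC 2 ab in \<open>auto simp: D\<close>)
    next
      case 3
      have "(e, e') \<notin> ?D" for e
        using 3 ab D[of "fst e" "snd e" a b] by auto
      then show ?thesis using partial_tilings_tgt[OF C 3(1,2)] by simp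
    qed
  qed
  show ?thesis
    using 1 2 3 4 unfolding partial_tilings_def matchings_def by simp
qed

text \<open>Column \<open>n + 1\<close> has no sources, so its left triangles are covered from
  column \<open>n\<close>, each from one of two neighbouring places. Which of the two it is
  determines \<open>E\<close>.\<close>

lemma partial_tilings_restrict:
  assumes Y0: "Y 0 = s ` {0..<N}" and t: "strict_mono_on {0..<N} t"
    and C: "C \<in> partial_tilings N Y (Suc n) t"
  defines "E \<equiv> {j. j < N \<and> ((int n, t j - 1), (int n + 1, t j)) \<in> C}"
    and "C' \<equiv> {c \<in> C. fst (fst c) < int n}"
  shows "E \<in> downsteps N (Y (int n)) t" "C' \<in> partial_tilings N Y n (lower E t)"
    "C = C' \<union> last_strip N (Y (int n)) (int n) t E"
proof -
  have Cs: "((a, b), (a', b')) \<in> arrows" "0 \<le> a" "a \<le> int n" "b \<in> Y a" "(a', b') \<in> tgts Y (Suc n) (t ` {0..<N})"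
    if "((a, b), (a', b')) \<in> C" for a b a' b'
    using partial_tilings_sub[OF C] that by (auto simp: srcs_def)
  have src: "\<exists>!e'. (e, e') \<in> C" if "e \<in> srcs Y (Suc n)" for e
    using partial_tilings_src[OF C that] .
  have tgt: "\<exists>!e'. (e', e) \<in> C" if "e \<in> tgts Y (Suc n) (t ` {0..<N})" for e
    using partial_tilings_tgt[OF C _ that] by simp
  have arr: "((int n, lower E t j), (int n + 1, t j)) \<in> C" if j: "j < N" for j
  proof -
    have "(int n + 1, t j) \<in> tgts Y (Suc n) (t ` {0..<N})" using j by (auto simp: tgts_def)
    from ex1_implies_ex[OF tgt[OF this]] obtain a b where ab: "((a, b), (int n + 1, t j)) \<in> C" by auto
    have "a = int n" "b = t j \<or> b = t j - 1" using Cs[OF ab] by (auto simp: arrows_def)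
    then show ?thesis using ab j by (auto simp: lower_def E_def)
  qed
  have func: "e' = e''" if "(e, e') \<in> C" "(e, e'') \<in> C" for e e' e''
    using src[of e] that partial_tilings_sub[OF C] by blast
  have injC: "e' = e''" if "(e', e) \<in> C" "(e'', e) \<in> C" for e e' e''
    using tgt[of e] that partial_tilings_sub[OF C] by blast
  have linj: "inj_on (lower E t) {0..<N}"
  proof (rule inj_onI)
    fix i j assume "i \<in> {0..<N}" "j \<in> {0..<N}" "lower E t i = lower E t j"
    then have "(int n + 1, t i) = (int n + 1, t j)"
      using arr[of i] arr[of j] func by auto
    then show "i = j" using strict_mono_on_imp_inj_on[OF t] \<open>i \<in> _\<close> \<open>j \<in> _\<close> by (auto simp: inj_on_def)
  qed
  have lY: "lower E t ` {0..<N} \<subseteq> Y (int n)" using Cs(4)[OF arr] by auto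
  show E: "E \<in> downsteps N (Y (int n)) t"
    using lower_strict_mono[OF t linj] lY by (auto simp: downsteps_def E_def)
  \<comment> \<open>Such an arrow ends at some \<open>t j\<close>, and by uniqueness of the cover
    there it is the one found in \<open>arr\<close>.\<close>
  have up: "\<exists>j<N. b = lower E t j \<and> b' = t j" if c: "((int n, b), (a', b')) \<in> C" "a' \<noteq> int n" for a' b b'
  proof -
    have "a' = int n + 1" using Cs(1)[OF c(1)] c(2) by (auto simp: arrows_def)
    moreover from this have "b' \<in> t ` {0..<N}" using Cs(5)[OF c(1)] by (auto simp: tgts_def)
    then obtain j where "j < N" "b' = t j" by auto
    ultimately show ?thesis using injC[OF c(1)] arr[of j] by auto
  qed
  have fix': "((int n, b), (int n, b)) \<in> C" if "b \<in> Y (int n)" "b \<notin> lower E t ` {0..<N}" for b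
  proof -
    have "(int n, b) \<in> srcs Y (Suc n)" using that by (auto simp: srcs_def)
    from ex1_implies_ex[OF src[OF this]] obtain a' b' where c: "((int n, b), (a', b')) \<in> C" by auto
    have "a' = int n"
    proof (rule ccontr)
      assume "a' \<noteq> int n"
      from up[OF c this] obtain j where "j < N" "b = lower E t j" by auto
      then show False using that(2) by simp
    qed
    then show ?thesis using c Cs(1)[OF c] by (auto simp: arrows_def)
  qed
  have nofix: "((int n, b), (int n, b')) \<notin> C" if "b \<in> lower E t ` {0..<N}" for b b'
  proof
    assume c: "((int n, b), (int n, b')) \<in> C"
    from that obtain j where j: "j < N" "b = lower E t j" by auto
    from func[OF c[unfolded j(2)] arr[OF j(1)]] show False by simp
  qed
  show eq: "C = C' \<union> last_strip N (Y (int n)) (int n) t E"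
  proof (intro equalityI subsetI)
    fix c assume c: "c \<in> C"
    obtain a b a' b' where cc: "c = ((a, b), (a', b'))" by (metis prod.collapse)
    show "c \<in> C' \<union> last_strip N (Y (int n)) (int n) t E"
    proof (cases "a < int n")
      case True
      then show ?thesis using c cc by (auto simp: C'_def)
    next
      case False
      then have a: "a = int n" using Cs(3) c cc by force
      show ?thesis
      proof (cases "a' = int n")
        case True
        then have "b' = b" "b \<in> Y (int n)" "b \<notin> lower E t ` {0..<N}"
          using Cs(1,4)[of a b a' b'] c cc a nofix[of b b'] by (auto simp: arrows_def)
        then show ?thesis using cc a True by (auto simp: last_strip_def)
      next
        case False
        moreover have "a' = int n + 1" using Cs(1)[of a b a' b'] c cc a False by (auto simp: arrows_def)
        ultimately show ?thesis using up[of b a' b'] c cc a by (auto simp: last_strip_def)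
      qed
    qed
  next
    fix c assume "c \<in> C' \<union> last_strip N (Y (int n)) (int n) t E"
    then show "c \<in> C" using arr fix' by (auto simp: C'_def last_strip_def)
  qed
  show "C' \<in> partial_tilings N Y n (lower E t)"
  proof (cases "n = 0")
    case True
    have "C' = {}" using True Cs(2) by (fastforce simp: C'_def)
    moreover have "Y 0 \<subseteq> lower E t ` {0..<N}"
    proof
      fix b assume b: "b \<in> Y 0"
      show "b \<in> lower E t ` {0..<N}"
      proof (rule ccontr)
        assume "b \<notin> lower E t ` {0..<N}"
        from Cs(5)[OF fix'[of b]] b this show False using True by (auto simp: tgts_def)
      qed
    qed
    ultimately show ?thesis using lY True by (auto simp: partial_tilings_def)
  next
    case False
    have 1: "C' \<subseteq> arrows" using partial_tilings_sub[OF C] by (auto simp: C'_def)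
    have 2: "C' \<subseteq> srcs Y n \<times> tgts Y n (lower E t ` {0..<N})"
    proof
      fix c assume c: "c \<in> C'"
      obtain a b a' b' where cc: "c = ((a, b), (a', b'))" by (metis prod.collapse)
      have cC: "((a, b), (a', b')) \<in> C" and a: "a < int n" using c cc by (auto simp: C'_def)
      have "a' \<le> int n" using Cs(1)[OF cC] a by (auto simp: arrows_def)
      \<comment> \<open>A place free of paths already has its left triangle covered by the lozenge
        of \<open>fix'\<close>, so an arrow from an earlier column cannot end there.\<close>
      moreover have "b' \<in> lower E t ` {0..<N}" if "a' = int n"
      proof (rule ccontr)
        assume n: "b' \<notin> lower E t ` {0..<N}"
        have "b' \<in> Y (int n)" using Cs(5)[OF cC] that by (auto simp: tgts_def)
        from injC[OF cC[unfolded that] fix'[OF this n]] a show False by simp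
      qed
      ultimately show "c \<in> srcs Y n \<times> tgts Y n (lower E t ` {0..<N})"
        using Cs[OF cC] a by (auto simp: cc srcs_def tgts_def)
    qed
    have 3: "\<exists>!e'. (e, e') \<in> C'" if "e \<in> srcs Y n" for e
    proof -
      obtain a b where ab: "e = (a, b)" by (cases e)
      have "e \<in> srcs Y (Suc n)" "(e, e') \<in> C' \<longleftrightarrow> (e, e') \<in> C" for e'
        using that by (auto simp: ab srcs_def C'_def)
      then show ?thesis using src[of e] by simp
    qed
    have 4: "\<exists>!e. (e, e') \<in> C'" if e': "e' \<in> tgts Y n (lower E t ` {0..<N})" for e'
    proof -
      have "e' \<in> tgts Y (Suc n) (t ` {0..<N})" using e' lY False by (auto simp: tgts_def)
      from ex1_implies_ex[OF tgt[OF this]] obtain e where e: "(e, e') \<in> C" by auto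
      have "fst e < int n"
      proof (rule ccontr)
        obtain a b a' b' where ab: "e = (a, b)" "e' = (a', b')" by (cases e, cases e')
        assume "\<not> fst e < int n"
        then have a: "a = int n" using Cs(3)[of a b a' b'] e ab by auto
        have "a' \<le> int n" using e' ab by (auto simp: tgts_def)
        then have "a' = int n \<and> b' = b" using Cs(1)[of a b a' b'] e ab a by (auto simp: arrows_def)
        then show False using nofix[of b b] e' e ab a by (auto simp: tgts_def)
      qed
      then show ?thesis using e by (intro ex1I[of _ e]) (auto simp: C'_def dest: injC[OF e])
    qed
    show ?thesis using 1 2 3 4 False unfolding partial_tilings_def matchings_def by simp
  qed
qed

lemma finite_srcs: "(\<And>a. finite (Y a)) \<Longrightarrow> finite (srcs Y n)"
  by (rule finite_subset[of _ "Sigma {0..<int n} Y"]) (auto simp: srcs_def)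

lemma finite_tgts: "(\<And>a. finite (Y a)) \<Longrightarrow> finite T \<Longrightarrow> finite (tgts Y n T)"
  by (rule finite_subset[of _ "Sigma {0..<int n} Y \<union> {int n} \<times> T"]) (auto simp: tgts_def)

lemma finite_partial_tilings:
  assumes "\<And>a. finite (Y a)" shows "finite (partial_tilings N Y n t)"
proof (rule finite_subset)
  show "partial_tilings N Y n t \<subseteq> Pow (srcs Y n \<times> tgts Y n (t ` {0..<N}))"
    using partial_tilings_sub by blast
  show "finite (Pow (srcs Y n \<times> tgts Y n (t ` {0..<N})))"
    using finite_srcs[of Y n] finite_tgts[of Y "t ` {0..<N}" n] assms by auto
qed

lemma card_partial_tilings_Suc:
  assumes Y0: "Y 0 = s ` {0..<N}" and t: "strict_mono_on {0..<N} t" and Y: "\<And>a. finite (Y a)"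
  shows "card (partial_tilings N Y (Suc n) t) = (\<Sum>E\<in>downsteps N (Y (int n)) t. card (partial_tilings N Y n (lower E t)))"
proof -
  define ext where "ext = (\<lambda>(E, C). C \<union> last_strip N (Y (int n)) (int n) t E)"
  define D where "D = (SIGMA E:downsteps N (Y (int n)) t. partial_tilings N Y n (lower E t))"
  define res where "res = (\<lambda>C. ({j. j < N \<and> ((int n, t j - 1), (int n + 1, t j)) \<in> C}, {c \<in> C. fst (fst c) < int n}))"
  have "bij_betw ext D (partial_tilings N Y (Suc n) t)"
  proof (rule bij_betw_byWitness[where f' = res])
    show "ext ` D \<subseteq> partial_tilings N Y (Suc n) t"
      using partial_tilings_extend[OF t] by (auto simp: ext_def D_def)
    show "res ` partial_tilings N Y (Suc n) t \<subseteq> D"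
      using partial_tilings_restrict(1,2)[where s = s and Y = Y and N = N and t = t, OF Y0 t] by (auto simp: res_def D_def)
    show "\<forall>C\<in>partial_tilings N Y (Suc n) t. ext (res C) = C"
      using partial_tilings_restrict(3)[where s = s and Y = Y and N = N and t = t, OF Y0 t] by (auto simp: res_def ext_def)
    show "\<forall>a\<in>D. res (ext a) = a"
    proof
      fix a assume "a \<in> D"
      then obtain E C where a: "a = (E, C)" and E: "E \<in> downsteps N (Y (int n)) t"
        and C: "C \<in> partial_tilings N Y n (lower E t)" by (auto simp: D_def)
      have Cs: "fst (fst c) < int n" if "c \<in> C" for c
        using partial_tilings_sub[OF C] that by (auto simp: srcs_def)
      have tinj: "t i = t j \<longleftrightarrow> i = j" if "i < N" "j < N" for i j
        using strict_mono_on_imp_inj_on[OF t] that by (auto simp: inj_on_def)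
      have "{j. j < N \<and> ((int n, t j - 1), (int n + 1, t j)) \<in> C \<union> last_strip N (Y (int n)) (int n) t E} = E"
        using E Cs by (fastforce simp: last_strip_def downsteps_def lower_def tinj)
      moreover have "{c \<in> C \<union> last_strip N (Y (int n)) (int n) t E. fst (fst c) < int n} = C"
        using Cs by (auto simp: last_strip_def)
      ultimately show "res (ext a) = a" by (simp add: a res_def ext_def)
    qed
  qed
  then have "card (partial_tilings N Y (Suc n) t) = card D"
    by (simp add: bij_betw_same_card)
  also have "\<dots> = (\<Sum>E\<in>downsteps N (Y (int n)) t. card (partial_tilings N Y n (lower E t)))"
    unfolding D_def by (rule card_SigmaI) (auto intro: finite_partial_tilings Y)
  finally show ?thesis .
qed

lemma card_partial_tilings:
  assumes s: "strict_mono_on {0..<N} s" "Y 0 = s ` {0..<N}" and Y: "\<And>a. finite (Y a)"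
    and t: "strict_mono_on {0..<N} t"
  shows "card (partial_tilings N Y n t) = path_families N Y s n t"
  using t
proof (induction n arbitrary: t)
  case 0
  have "t ` {0..<N} = Y 0 \<longleftrightarrow> (\<forall>j<N. t j = s j)"
    using strict_mono_on_image_unique[OF s(1) 0] s(2) by (auto intro!: image_cong)
  then show ?case by (auto simp: partial_tilings_def)
next
  case (Suc n)
  show ?case unfolding card_partial_tilings_Suc[where s = s and Y = Y and N = N and t = t, OF s(2) Suc.prems Y]
    by (auto intro!: sum.cong Suc.IH simp: downsteps_def)
qed

section \<open>Geometric tilings as combinatorial tilings\<close>

text \<open>Open and closed unit triangles, indexed by their vertical side and the side of it
  on which they lie (\<^term>\<open>True\<close> means to the right).\<close>

fun otri :: "bool \<Rightarrow> int \<times> int \<Rightarrow> (real \<times> real) set" where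
  "otri True (a, b) = {(x, y). of_int a < x \<and> y < of_int b + 1 \<and> x - of_int a < y - of_int b}"
| "otri False (a, b) = {(x, y). of_int b < y \<and> x < of_int a \<and> y - of_int b < x - of_int a + 1}"

fun ctri :: "bool \<Rightarrow> int \<times> int \<Rightarrow> (real \<times> real) set" where
  "ctri True (a, b) = {(x, y). of_int a \<le> x \<and> y \<le> of_int b + 1 \<and> x - of_int a \<le> y - of_int b}"
| "ctri False (a, b) = {(x, y). of_int b \<le> y \<and> x \<le> of_int a \<and> y - of_int b \<le> x - of_int a + 1}"

text \<open>The centroid: there each of the three inequalities that define the triangle has slack
  1/3.\<close>

fun center :: "bool \<Rightarrow> int \<times> int \<Rightarrow> real \<times> real" where
  "center True (a, b) = (of_int a + 1/3, of_int b + 2/3)"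
| "center False (a, b) = (of_int a - 1/3, of_int b + 1/3)"

fun loz :: "(int \<times> int) \<times> (int \<times> int) \<Rightarrow> (real \<times> real) set" where
  "loz (e, e') = ctri True e \<union> ctri False e'"

lemma center_in_otri: "center c e \<in> otri c e"
  by (cases c; cases e) auto

lemma otri_subset_ctri: "otri c e \<subseteq> ctri c e"
  by (cases c; cases e) auto

lemma open_otri: "open (otri c e)"
proof -
  obtain a b where e: "e = (a, b)" by (cases e)
  have *: "otri c e = (if c then {p. of_int a < fst p} \<inter> {p. snd p < of_int b + 1} \<inter> {p. fst p - of_int a < snd p - of_int b}
     else {p. of_int b < snd p} \<inter> {p. fst p < of_int a} \<inter> {p. snd p - of_int b < fst p - of_int a + 1})"
    by (cases c) (auto simp: e)
  show ?thesis unfolding * by (auto intro!: open_Int open_Collect_less continuous_intros)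
qed

lemma closed_ctri: "closed (ctri c e)"
proof -
  obtain a b where e: "e = (a, b)" by (cases e)
  have *: "ctri c e = (if c then {p. of_int a \<le> fst p} \<inter> {p. snd p \<le> of_int b + 1} \<inter> {p. fst p - of_int a \<le> snd p - of_int b}
     else {p. of_int b \<le> snd p} \<inter> {p. fst p \<le> of_int a} \<inter> {p. snd p - of_int b \<le> fst p - of_int a + 1})"
    by (cases c) (auto simp: e)
  show ?thesis unfolding * by (auto intro!: closed_Int closed_Collect_le continuous_intros)
qed

text \<open>No lattice line of the three families meets an open triangle, so every comparison with
  an integer is decided by the index of the triangle.\<close>

lemma otri_floor:
  assumes "(x, y) \<in> otri c (a, b)"
  shows "of_int k \<le> x \<longleftrightarrow> k \<le> a - of_bool (\<not> c)" "x \<le> of_int k \<longleftrightarrow> a - of_bool (\<not> c) < k"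
    "of_int k \<le> y \<longleftrightarrow> k \<le> b" "y \<le> of_int k \<longleftrightarrow> b < k"
    "of_int k \<le> y - x \<longleftrightarrow> k \<le> b - a" "y - x \<le> of_int k \<longleftrightarrow> b - a < k"
proof -
  have x: "of_int (a - of_bool (\<not> c)) < x \<and> x < of_int (a - of_bool (\<not> c)) + 1"
    and y: "of_int b < y \<and> y < of_int b + 1"
    and z: "of_int (b - a) < y - x \<and> y - x < of_int (b - a) + 1"
    using assms by (cases c; auto)+
  have ge: "of_int k \<le> w \<longleftrightarrow> k \<le> m" and le: "w \<le> of_int k \<longleftrightarrow> m < k"
    if "of_int m < w \<and> w < of_int m + 1" for m :: int and w :: real
  proof -
    show "of_int k \<le> w \<longleftrightarrow> k \<le> m"
    proof
      assume "of_int k \<le> w"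
      then have "real_of_int k < of_int (m + 1)" using that by simp
      then show "k \<le> m" by linarith
    next
      assume "k \<le> m"
      then have "real_of_int k \<le> of_int m" by simp
      then show "of_int k \<le> w" using that by linarith
    qed
    show "w \<le> of_int k \<longleftrightarrow> m < k"
    proof
      assume "w \<le> of_int k"
      then have "real_of_int m < of_int k" using that by linarith
      then show "m < k" by simp
    next
      assume "m < k"
      then have "real_of_int (m + 1) \<le> of_int k" by linarith
      then show "w \<le> of_int k" using that by simp
    qed
  qed
  show "of_int k \<le> x \<longleftrightarrow> k \<le> a - of_bool (\<not> c)" "x \<le> of_int k \<longleftrightarrow> a - of_bool (\<not> c) < k"
    "of_int k \<le> y \<longleftrightarrow> k \<le> b" "y \<le> of_int k \<longleftrightarrow> b < k"
    "of_int k \<le> y - x \<longleftrightarrow> k \<le> b - a" "y - x \<le> of_int k \<longleftrightarrow> b - a < k"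
    by (fact ge[OF x] le[OF x] ge[OF y] le[OF y] ge[OF z] le[OF z])+
qed

text \<open>The integer parts of \<open>y\<close> and \<open>y - x\<close> give \<open>b\<close> and
  \<open>a\<close>; that of \<open>x\<close> then tells the side.\<close>

lemma otri_meets_ctri:
  assumes "p \<in> otri c e" "p \<in> ctri c' e'"
  shows "c' = c \<and> e' = e"
proof -
  obtain x y a b a' b' where p: "p = (x, y)" "e = (a, b)" "e' = (a', b')"
    by (metis prod.collapse)
  note F = otri_floor[OF assms(1)[unfolded p]]
  have 1: "of_int (a' - of_bool (\<not> c')) \<le> x" "x \<le> of_int (a' - of_bool (\<not> c') + 1)"
    "of_int b' \<le> y" "y \<le> of_int (b' + 1)" "of_int (b' - a') \<le> y - x" "y - x \<le> of_int (b' - a' + 1)"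
    using assms(2) p by (cases c'; auto)+
  have "b' = b" "b' - a' = b - a" "a' - of_bool (\<not> c') = a - of_bool (\<not> c)"
    using 1 unfolding F by linarith+
  then have "b' = b" "a' = a" "of_bool (\<not> c') = (of_bool (\<not> c) :: int)" by linarith+
  then show ?thesis using p by (auto split: if_splits)
qed

text \<open>The defining inequalities are affine, weak at \<open>p\<close> and strict at the centre,
  hence strict along the segment between them, except possibly at \<open>p\<close>.\<close>

lemma ctri_subset_closure_otri: "ctri c e \<subseteq> closure (otri c e)"
proof
  fix p assume p: "p \<in> ctri c e"
  show "p \<in> closure (otri c e)"
    unfolding closure_approachable
  proof (intro allI impI)
    fix \<epsilon> :: real assume \<epsilon>: "0 < \<epsilon>"
    define v where "v = center c e - p"
    \<comment> \<open>The \<open>+ 1\<close> keeps the denominator positive when \<open>p\<close> is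
      the centre.\<close>
    define t where "t = min 1 (\<epsilon> / (2 * (norm v + 1)))"
    have t: "0 < t" "t \<le> 1" using \<epsilon> by (auto simp: t_def add_nonneg_pos)
    have "t * norm v \<le> \<epsilon> / (2 * (norm v + 1)) * norm v"
      by (intro mult_right_mono) (auto simp: t_def)
    also have "\<dots> = \<epsilon> * (norm v / (2 * (norm v + 1)))" by simp
    also have "\<dots> < \<epsilon> * 1"
    proof (rule mult_strict_left_mono[OF _ \<epsilon>])
      have "n / (2 * (n + 1)) < 1" if "0 \<le> n" for n :: real
        using that by (simp add: divide_less_eq)
      then show "norm v / (2 * (norm v + 1)) < 1" using norm_ge_zero by blast
    qed
    also have "\<dots> = \<epsilon>" by simp
    finally have d: "dist (p + t *\<^sub>R v) p < \<epsilon>" using t by (simp add: dist_norm)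
    have "p + t *\<^sub>R v \<in> otri c e"
    proof -
      obtain x y a b where xy: "p = (x, y)" "e = (a, b)" by (metis prod.collapse)
      have mix: "0 < (1 - t) * u + t * w" if "0 \<le> u" "0 < w" for u w :: real
        using t that by (intro add_nonneg_pos mult_nonneg_nonneg mult_pos_pos) auto
      show ?thesis
      proof (cases c)
        case True
        have "0 < (1 - t) * (x - a) + t * (1/3)" "0 < (1 - t) * (b + 1 - y) + t * (1/3)"
          "0 < (1 - t) * (y - b - (x - a)) + t * (1/3)"
          by (rule mix; use p True xy in simp)+
        then show ?thesis using True xy by (simp add: v_def algebra_simps)
      next
        case False
        have "0 < (1 - t) * (y - b) + t * (1/3)" "0 < (1 - t) * (a - x) + t * (1/3)"
          "0 < (1 - t) * (x - a + 1 - (y - b)) + t * (1/3)"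
          by (rule mix; use p False xy in simp)+
        then show ?thesis using False xy by (simp add: v_def algebra_simps)
      qed
    qed
    then show "\<exists>q\<in>otri c e. dist q p < \<epsilon>" using d by blast
  qed
qed

text \<open>The direction \<open>(1, 2)\<close> is transversal to all three families of lattice lines.\<close>

lemma perturb_into_otri:
  obtains c e \<delta>0 where "0 < \<delta>0" "p \<in> ctri c e"
    "\<And>\<delta>. 0 < \<delta> \<Longrightarrow> \<delta> < \<delta>0 \<Longrightarrow> p + \<delta> *\<^sub>R (1, 2) \<in> otri c e"
proof -
  obtain x y where p: "p = (x, y)" by (cases p)
  define a b where "a = \<lfloor>x\<rfloor>" "b = \<lfloor>y\<rfloor>"
  have ab: "of_int a \<le> x" "x < of_int a + 1" "of_int b \<le> y" "y < of_int b + 1"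
    unfolding a_b_def by linarith+
  \<comment> \<open>Along \<open>(1, 2)\<close> the difference \<open>y - x\<close> grows, so a
    point on a diagonal lattice line moves into the right triangle; ties belong to the first
    case.\<close>
  show ?thesis
  proof (cases "x - of_int a \<le> y - of_int b")
    case True
    show ?thesis
      by (rule that[of "(of_int b + 1 - y) / 2" True "(a, b)"]) (use p True ab in \<open>auto simp: field_simps\<close>)
  next
    case False
    show ?thesis
      by (rule that[of "min (of_int a + 1 - x) (x - of_int a - (y - of_int b))" False "(a + 1, b)"])
        (use p False ab in \<open>auto simp: field_simps\<close>)
  qed
qed

text \<open>Supplies, in any nonempty open set, a point at which membership in regions bounded by
  lattice lines can be read off from integers.\<close>

lemma open_meets_otri:
  assumes "open W" "p \<in> W"
  obtains c e q where "p \<in> ctri c e" "q \<in> otri c e" "q \<in> W"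
proof -
  obtain c e \<delta>0 where d: "0 < \<delta>0" "p \<in> ctri c e"
    "\<And>\<delta>. 0 < \<delta> \<Longrightarrow> \<delta> < \<delta>0 \<Longrightarrow> p + \<delta> *\<^sub>R (1, 2) \<in> otri c e"
    using perturb_into_otri[of p] by metis
  obtain \<epsilon> where e: "0 < \<epsilon>" "ball p \<epsilon> \<subseteq> W" using assms open_contains_ball by blast
  define \<delta> where "\<delta> = min (\<delta>0 / 2) (\<epsilon> / (2 * norm (1::real, 2::real)))"
  have n: "0 < norm (1::real, 2::real)" by (simp add: zero_prod_def)
  have "0 < \<delta>" "\<delta> < \<delta>0" using d(1) e(1) n by (auto simp: \<delta>_def)
  have "\<delta> * norm (1::real, 2::real) \<le> \<epsilon> / (2 * norm (1::real, 2::real)) * norm (1::real, 2::real)"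
    by (intro mult_right_mono) (auto simp: \<delta>_def)
  also have "\<dots> < \<epsilon>" using e(1) n by simp
  finally have "p + \<delta> *\<^sub>R (1, 2) \<in> ball p \<epsilon>"
    using \<open>0 < \<delta>\<close> by (simp add: dist_norm del: scaleR_Pair)
  then show ?thesis using that[OF d(2) d(3)[OF \<open>0 < \<delta>\<close> \<open>\<delta> < \<delta>0\<close>]] e(2) by blast
qed

section \<open>Lozenges as regions bounded by lattice lines\<close>

lemma convex_hull_parallelogram:
  fixes p v w :: "'a::real_vector"
  shows "convex hull {p, p + v, p + v + w, p + w} =
    {p + s *\<^sub>R v + t *\<^sub>R w | s t. 0 \<le> s \<and> s \<le> 1 \<and> 0 \<le> t \<and> t \<le> 1}" (is "?H = ?P")
proof
  show "?H \<subseteq> ?P"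
  proof (rule hull_minimal)
    show "{p, p + v, p + v + w, p + w} \<subseteq> ?P"
    proof -
      have "p + s *\<^sub>R v + t *\<^sub>R w \<in> ?P" if "s \<in> {0, 1}" "t \<in> {0, 1}" for s t
        using that by (intro CollectI exI[of _ s] exI[of _ t]) auto
      from this[of 0 0] this[of 1 0] this[of 1 1] this[of 0 1] show ?thesis by simp
    qed
    show "convex ?P"
    proof (rule convexI)
      fix x y and \<alpha> \<beta> :: real
      assume x: "x \<in> ?P" and y: "y \<in> ?P" and \<alpha>: "0 \<le> \<alpha>" "0 \<le> \<beta>" "\<alpha> + \<beta> = 1"
      obtain s t s' t' where st: "x = p + s *\<^sub>R v + t *\<^sub>R w" "0 \<le> s" "s \<le> 1" "0 \<le> t" "t \<le> 1"
        "y = p + s' *\<^sub>R v + t' *\<^sub>R w" "0 \<le> s'" "s' \<le> 1" "0 \<le> t'" "t' \<le> 1"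
        using x y by blast
      have "\<alpha> *\<^sub>R x + \<beta> *\<^sub>R y = (\<alpha> + \<beta>) *\<^sub>R p + (\<alpha> * s + \<beta> * s') *\<^sub>R v + (\<alpha> * t + \<beta> * t') *\<^sub>R w"
        by (simp add: st algebra_simps)
      then have "\<alpha> *\<^sub>R x + \<beta> *\<^sub>R y = p + (\<alpha> * s + \<beta> * s') *\<^sub>R v + (\<alpha> * t + \<beta> * t') *\<^sub>R w"
        using \<alpha> by simp
      moreover have "\<alpha> * s + \<beta> * s' \<le> 1" "\<alpha> * t + \<beta> * t' \<le> 1"
        using st \<alpha> by (auto intro!: convex_bound_le)
      moreover have "0 \<le> \<alpha> * s + \<beta> * s'" "0 \<le> \<alpha> * t + \<beta> * t'" using st \<alpha> by auto
      ultimately show "\<alpha> *\<^sub>R x + \<beta> *\<^sub>R y \<in> ?P" by blast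
    qed
  qed
  show "?P \<subseteq> ?H"
  proof
    fix x assume "x \<in> ?P"
    then obtain s t where st: "x = p + s *\<^sub>R v + t *\<^sub>R w" "0 \<le> s" "s \<le> 1" "0 \<le> t" "t \<le> 1" by blast
    have c: "convex ?H" by simp
    have h: "p \<in> ?H" "p + v \<in> ?H" "p + v + w \<in> ?H" "p + w \<in> ?H"
      by (auto intro: hull_inc)
    have 1: "(1 - s) *\<^sub>R p + s *\<^sub>R (p + v) \<in> ?H" by (rule convexD[OF c h(1,2)]) (use st in auto)
    have 2: "(1 - s) *\<^sub>R (p + w) + s *\<^sub>R (p + v + w) \<in> ?H" by (rule convexD[OF c h(4,3)]) (use st in auto)
    have "(1 - t) *\<^sub>R ((1 - s) *\<^sub>R p + s *\<^sub>R (p + v)) + t *\<^sub>R ((1 - s) *\<^sub>R (p + w) + s *\<^sub>R (p + v + w)) \<in> ?H"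
      by (rule convexD[OF c 1 2]) (use st in auto)
    also have "(1 - t) *\<^sub>R ((1 - s) *\<^sub>R p + s *\<^sub>R (p + v)) + t *\<^sub>R ((1 - s) *\<^sub>R (p + w) + s *\<^sub>R (p + v + w)) = x"
      by (simp add: st algebra_simps)
    finally show "x \<in> ?H" .
  qed
qed

text \<open>The sides are \<open>(s, 0)\<close> and \<open>(s, s)\<close>, so the boundary consists
  of two horizontal lines and two lines of slope 1, all of which \<open>otri_floor\<close> can
  handle.\<close>

lemma large_lozenge_eq:
  assumes "a \<le> b"
  shows "large_lozenge r a b = {(x, y). of_int a \<le> y \<and> y \<le> of_int b + 1 \<and>
    of_int a - real r \<le> y - x \<and> y - x \<le> of_int b + 1 - real r}" (is "_ = ?R")
proof -
  define s where "s = real_of_int (b - a + 1)"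
  have s: "0 < s" "of_int b = of_int a + s - (1::real)" using assms by (auto simp: s_def)
  have corners: "(real r, real_of_int a) = (real r - s, real_of_int a) + (s, 0)"
    "(real r + s, real_of_int b + 1) = (real r - s, real_of_int a) + (s, 0) + (s, s)"
    "(real r, real_of_int b + 1) = (real r - s, real_of_int a) + (s, s)"
    using s by simp_all
  have "large_lozenge r a b = convex hull {(real r - s, real_of_int a), (real r, real_of_int a),
    (real r + s, real_of_int b + 1), (real r, real_of_int b + 1)}"
    unfolding large_lozenge_def Let_def s_def ..
  also have "\<dots> = convex hull {(real r - s, real_of_int a), (real r - s, real_of_int a) + (s, 0),
    (real r - s, real_of_int a) + (s, 0) + (s, s), (real r - s, real_of_int a) + (s, s)}"
    unfolding corners ..
  also have "\<dots> = ?R"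
    unfolding convex_hull_parallelogram
  proof (intro equalityI subsetI)
    fix p assume "p \<in> {(real r - s, real_of_int a) + u *\<^sub>R (s, 0) + t *\<^sub>R (s, s) | u t. 0 \<le> u \<and> u \<le> 1 \<and> 0 \<le> t \<and> t \<le> 1}"
    then obtain u t where ut: "p = (real r - s + u * s + t * s, real_of_int a + t * s)" "0 \<le> u" "u \<le> 1" "0 \<le> t" "t \<le> 1"
      by auto
    have "0 \<le> t * s" "t * s \<le> s" "0 \<le> u * s" "u * s \<le> s" using ut s by (auto simp: mult_left_le_one_le)
    then show "p \<in> ?R" using s ut by auto
  next
    fix p assume "p \<in> ?R"
    then obtain x y where p: "p = (x, y)" "of_int a \<le> y" "y \<le> of_int b + 1" "of_int a - real r \<le> y - x" "y - x \<le> of_int b + 1 - real r"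
      by auto
    define t where "t = (y - of_int a) / s"
    define u where "u = (x - real r + s - (y - of_int a)) / s"
    have "t * s = y - of_int a" "u * s = x - real r + s - (y - of_int a)" using s by (auto simp: t_def u_def)
    then have "p = (real r - s, real_of_int a) + u *\<^sub>R (s, 0) + t *\<^sub>R (s, s)"
      using p by simp
    moreover have "0 \<le> t" "t \<le> 1" "0 \<le> u" "u \<le> 1" using p s by (auto simp: t_def u_def field_simps)
    ultimately show "p \<in> {(real r - s, real_of_int a) + u *\<^sub>R (s, 0) + t *\<^sub>R (s, s) | u t. 0 \<le> u \<and> u \<le> 1 \<and> 0 \<le> t \<and> t \<le> 1}"
      by blast
  qed
  finally show ?thesis .
qed

lemma unit_parallelogram_eqs:
  "convex hull {(0, 0), (0, 1), (1, 2), (1, 1)} = {(x, y). 0 \<le> x \<and> x \<le> 1 \<and> 0 \<le> y - x \<and> y - x \<le> (1::real)}" (is ?A)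
  "convex hull {(0, 0), (0, 1), (1, 1), (1, 0)} = {(x, y). 0 \<le> x \<and> x \<le> (1::real) \<and> 0 \<le> y \<and> y \<le> (1::real)}" (is ?B)
  "convex hull {(0, 0), (1, 1), (2, 1), (1, 0)} = {(x, y). 0 \<le> x - y \<and> x - y \<le> 1 \<and> 0 \<le> y \<and> y \<le> (1::real)}" (is ?C)
proof -
  note P = convex_hull_parallelogram[of "(0::real, 0::real)"]
  have "?A \<longleftrightarrow> {(0, 0) + s *\<^sub>R (0, 1) + t *\<^sub>R (1, 1) | s t. 0 \<le> s \<and> s \<le> 1 \<and> 0 \<le> t \<and> t \<le> 1} =
    {(x, y). 0 \<le> x \<and> x \<le> 1 \<and> 0 \<le> y - x \<and> y - x \<le> (1::real)}"
    by (subst P[of "(0, 1)" "(1, 1)", symmetric]) simp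
  moreover have "\<exists>s t. (x, y) = (0, 0) + s *\<^sub>R (0, 1) + t *\<^sub>R (1, 1) \<and> 0 \<le> s \<and> s \<le> 1 \<and> 0 \<le> t \<and> t \<le> 1"
    if "0 \<le> x" "x \<le> 1" "0 \<le> y - x" "y - x \<le> 1" for x y :: real
    by (rule exI[of _ "y - x"], rule exI[of _ x]) (use that in auto)
  ultimately show ?A by auto
  have "?B \<longleftrightarrow> {(0, 0) + s *\<^sub>R (0, 1) + t *\<^sub>R (1, 0) | s t. 0 \<le> s \<and> s \<le> 1 \<and> 0 \<le> t \<and> t \<le> 1} =
    {(x, y). 0 \<le> x \<and> x \<le> (1::real) \<and> 0 \<le> y \<and> y \<le> (1::real)}"
    by (subst P[of "(0, 1)" "(1, 0)", symmetric]) simp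
  then show ?B by auto
  have "?C \<longleftrightarrow> {(0, 0) + s *\<^sub>R (1, 1) + t *\<^sub>R (1, 0) | s t. 0 \<le> s \<and> s \<le> 1 \<and> 0 \<le> t \<and> t \<le> 1} =
    {(x, y). 0 \<le> x - y \<and> x - y \<le> 1 \<and> 0 \<le> y \<and> y \<le> (1::real)}"
    by (subst P[of "(1, 1)" "(1, 0)", symmetric]) simp
  moreover have "\<exists>s t. (x, y) = (0, 0) + s *\<^sub>R (1, 1) + t *\<^sub>R (1, 0) \<and> 0 \<le> s \<and> s \<le> 1 \<and> 0 \<le> t \<and> t \<le> 1"
    if "0 \<le> x - y" "x - y \<le> 1" "0 \<le> y" "y \<le> 1" for x y :: real
    by (rule exI[of _ y], rule exI[of _ "x - y"]) (use that in auto)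
  ultimately show ?C by auto
qed

lemma translate_Collect:
  "(\<lambda>p. (u, v) + p) ` {(x, y). P x y} = {(x, y). P (x - u) (y - (v::real))}" for u :: real
proof (intro equalityI subsetI)
  fix p assume "p \<in> {(x, y). P (x - u) (y - v)}"
  then have "p = (u, v) + (fst p - u, snd p - v)" "(fst p - u, snd p - v) \<in> {(x, y). P x y}" by auto
  then show "p \<in> (\<lambda>p. (u, v) + p) ` {(x, y). P x y}" by blast
qed auto

text \<open>The left triangle at column \<open>a\<close> reaches back to column
  \<open>a - 1\<close>; hence the shift in the first equation.\<close>

lemma loz_eqs:
  "loz ((a, b), (a, b)) = (\<lambda>p. (of_int (a - 1), of_int b) + p) ` (convex hull {(0, 0), (1, 1), (2, 1), (1, 0)})"
  "loz ((a, b), (a + 1, b)) = (\<lambda>p. (of_int a, of_int b) + p) ` (convex hull {(0, 0), (0, 1), (1, 1), (1, 0)})"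
  "loz ((a, b), (a + 1, b + 1)) = (\<lambda>p. (of_int a, of_int b) + p) ` (convex hull {(0, 0), (0, 1), (1, 2), (1, 1)})"
  unfolding unit_parallelogram_eqs translate_Collect by auto

lemma lozenges_eq: "lozenges = loz ` arrows"
proof (intro equalityI subsetI)
  fix A assume "A \<in> lozenges"
  then obtain a b B where A: "A = (\<lambda>x. (real_of_int a, real_of_int b) + x) ` B" "B \<in> basic_lozenges"
    unfolding lozenges_def by blast
  have "A = loz ((a, b), (a + 1, b + 1)) \<or> A = loz ((a, b), (a + 1, b)) \<or> A = loz ((a + 1, b), (a + 1, b))"
    using A(2) unfolding A(1) loz_eqs basic_lozenges_def by auto
  moreover have "((a, b), (a + 1, b + 1)) \<in> arrows" "((a, b), (a + 1, b)) \<in> arrows" "((a + 1, b), (a + 1, b)) \<in> arrows"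
    by (auto simp: arrows_def)
  ultimately show "A \<in> loz ` arrows" by blast
next
  fix A assume "A \<in> loz ` arrows"
  then obtain a b a' b' where A: "A = loz ((a, b), (a', b'))"
    and "(a' = a \<and> b' = b) \<or> (a' = a + 1 \<and> (b' = b \<or> b' = b + 1))"
    unfolding arrows_def by blast
  then consider "A = loz ((a, b), (a, b))" | "A = loz ((a, b), (a + 1, b))" | "A = loz ((a, b), (a + 1, b + 1))"
    by auto
  then show "A \<in> lozenges"
  proof cases
    case 1
    show ?thesis unfolding lozenges_def 1 loz_eqs basic_lozenges_def by blast
  next
    case 2
    show ?thesis unfolding lozenges_def 2 loz_eqs basic_lozenges_def by blast
  next
    case 3
    show ?thesis unfolding lozenges_def 3 loz_eqs basic_lozenges_def by blast
  qed
qed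

lemma otri_meets_loz:
  assumes "p \<in> otri c e" "p \<in> loz l"
  shows "e = (if c then fst l else snd l)"
proof -
  obtain e1 e2 where l: "l = (e1, e2)" by (cases l)
  show ?thesis
    using assms(2) otri_meets_ctri[OF assms(1), of True e1] otri_meets_ctri[OF assms(1), of False e2]
    unfolding l by auto
qed

lemma otri_subset_loz: "otri True (fst l) \<subseteq> loz l" "otri False (snd l) \<subseteq> loz l"
  using otri_subset_ctri[of True "fst l"] otri_subset_ctri[of False "snd l"] by (cases l; auto)+

lemma inj_loz: "inj loz"
proof (rule injI)
  fix l l' assume eq: "loz l = loz l'"
  have "center True (fst l) \<in> loz l'" "center False (snd l) \<in> loz l'"
    using otri_subset_loz[of l] center_in_otri eq by blast+
  then have "fst l = fst l'" "snd l = snd l'"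
    using otri_meets_loz[OF center_in_otri] by (metis (full_types))+
  then show "l = l'" by (simp add: prod_eq_iff)
qed

text \<open>A common part of the interiors is open, so it is witnessed by a point of an open
  triangle, and this triangle belongs to both lozenges.\<close>

lemma interior_loz_disjoint_iff:
  "interior (loz l) \<inter> interior (loz l') = {} \<longleftrightarrow> fst l \<noteq> fst l' \<and> snd l \<noteq> snd l'"
proof
  assume d: "interior (loz l) \<inter> interior (loz l') = {}"
  have "otri True (fst l) \<subseteq> interior (loz l)" "otri False (snd l) \<subseteq> interior (loz l)" for l
    using otri_subset_loz open_otri by (simp_all add: interior_maximal)
  then show "fst l \<noteq> fst l' \<and> snd l \<noteq> snd l'"
    using d center_in_otri by (metis disjoint_iff subsetD)
next
  assume ne: "fst l \<noteq> fst l' \<and> snd l \<noteq> snd l'"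
  show "interior (loz l) \<inter> interior (loz l') = {}"
  proof (rule ccontr)
    assume "interior (loz l) \<inter> interior (loz l') \<noteq> {}"
    then obtain p where "p \<in> interior (loz l) \<inter> interior (loz l')" by blast
    moreover have "open (interior (loz l) \<inter> interior (loz l'))" by (intro open_Int open_interior)
    ultimately obtain c e q where q: "q \<in> otri c e" "q \<in> interior (loz l) \<inter> interior (loz l')"
      using open_meets_otri by metis
    then have "q \<in> loz l" "q \<in> loz l'" using interior_subset by blast+
    then show False using otri_meets_loz[OF q(1)] ne by (metis (full_types))
  qed
qed

text \<open>At the centre of a triangle, covering means at least one lozenge and disjointness of
  interiors at most one. A tiling thus gives every triangle exactly one partner.\<close>

lemma tilings_bij_matchings:
  assumes R: "closure R = (\<Union>e\<in>U. ctri True e) \<union> (\<Union>e\<in>W. ctri False e)"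
  shows "bij_betw ((`) loz) (matchings U W) {T. is_lozenge_tiling R T}"
proof -
  have U: "e \<in> U" if "center True e \<in> closure R" for e
    using that otri_meets_ctri[OF center_in_otri[of True e]] unfolding R by blast
  have W: "e \<in> W" if "center False e \<in> closure R" for e
    using that otri_meets_ctri[OF center_in_otri[of False e]] unfolding R by blast
  have cU: "center True e \<in> closure R" if "e \<in> U" for e
    using that center_in_otri[of True e] otri_subset_ctri[of True e] unfolding R by blast
  have cW: "center False e \<in> closure R" if "e \<in> W" for e
    using that center_in_otri[of False e] otri_subset_ctri[of False e] unfolding R by blast
  have fwd: "is_lozenge_tiling R (loz ` C)" if C: "C \<in> matchings U W" for C
    unfolding is_lozenge_tiling_def
  proof (intro conjI)
    have sub: "C \<subseteq> arrows" "C \<subseteq> U \<times> W" using C by (auto simp: matchings_def)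
    have u1: "\<exists>!e'. (e, e') \<in> C" if "e \<in> U" for e using C that by (simp add: matchings_def)
    have w1: "\<exists>!e'. (e', e) \<in> C" if "e \<in> W" for e using C that by (simp add: matchings_def)
    show "loz ` C \<subseteq> lozenges" using sub by (auto simp: lozenges_eq)
    show un: "\<Union> (loz ` C) = closure R"
    proof
      show "\<Union> (loz ` C) \<subseteq> closure R" using sub unfolding R by fastforce
      show "closure R \<subseteq> \<Union> (loz ` C)"
      proof
        fix p assume "p \<in> closure R"
        then consider e where "e \<in> U" "p \<in> ctri True e" | e where "e \<in> W" "p \<in> ctri False e"
          unfolding R by blast
        then show "p \<in> \<Union> (loz ` C)"
        proof cases
          case 1
          from ex1_implies_ex[OF u1[OF 1(1)]] obtain e' where "(e, e') \<in> C" ..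
          then show ?thesis using 1 by (intro UN_I[of "(e, e')"]) auto
        next
          case 2
          from ex1_implies_ex[OF w1[OF 2(1)]] obtain e' where "(e', e) \<in> C" ..
          then show ?thesis using 2 by (intro UN_I[of "(e', e)"]) auto
        qed
      qed
    qed
    show "\<forall>A\<in>loz ` C. A \<subseteq> closure R" using un by blast
    show "pairwise (\<lambda>A B. interior A \<inter> interior B = {}) (loz ` C)"
    proof (rule pairwiseI)
      fix A B assume "A \<in> loz ` C" "B \<in> loz ` C" "A \<noteq> B"
      then obtain e e' f f' where AB: "A = loz (e, e')" "B = loz (f, f')" "(e, e') \<in> C" "(f, f') \<in> C" "(e, e') \<noteq> (f, f')"
        by fast
      have "e \<in> U" "e' \<in> W" using AB sub by auto
      then have "e \<noteq> f" "e' \<noteq> f'" using AB u1[of e] w1[of e'] by blast+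
      then show "interior A \<inter> interior B = {}" using AB by (simp add: interior_loz_disjoint_iff del: loz.simps)
    qed
  qed
  have bwd: "\<exists>C\<in>matchings U W. T = loz ` C" if T: "is_lozenge_tiling R T" for T
  proof -
    define C where "C = {l \<in> arrows. loz l \<in> T}"
    have TC: "T = loz ` C" using T by (auto simp: is_lozenge_tiling_def lozenges_eq C_def)
    have un: "\<Union> (loz ` C) = closure R" using T by (simp add: is_lozenge_tiling_def TC)
    have sub: "C \<subseteq> U \<times> W"
    proof
      fix l assume l: "l \<in> C"
      then have "loz l \<subseteq> closure R" using un by blast
      then have "fst l \<in> U" "snd l \<in> W"
        using otri_subset_loz[of l] center_in_otri by (intro U W; blast)+
      then show "l \<in> U \<times> W" by (simp add: mem_Times_iff)
    qed
    have dis: "l = l' \<or> (fst l \<noteq> fst l' \<and> snd l \<noteq> snd l')" if "l \<in> C" "l' \<in> C" for l l'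
    proof (cases "l = l'")
      case False
      then have "loz l \<noteq> loz l'" using inj_loz by (auto dest: injD)
      then have "interior (loz l) \<inter> interior (loz l') = {}"
        using T that by (auto simp: is_lozenge_tiling_def TC pairwise_def simp del: loz.simps)
      then show ?thesis unfolding interior_loz_disjoint_iff by simp
    qed simp
    have "\<exists>!e'. (e, e') \<in> C" if e: "e \<in> U" for e
    proof -
      obtain l where l: "l \<in> C" "center True e \<in> loz l" using cU[OF e] un by blast
      then have "e = fst l" using otri_meets_loz[OF center_in_otri[of True e]] by auto
      then have "(e, snd l) \<in> C" using l by simp
      then show ?thesis using dis[of "(e, _)" "(e, _)"] by (intro ex1I[of _ "snd l"]) auto
    qed
    moreover have "\<exists>!e'. (e', e) \<in> C" if e: "e \<in> W" for e
    proof -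
      obtain l where l: "l \<in> C" "center False e \<in> loz l" using cW[OF e] un by blast
      then have "e = snd l" using otri_meets_loz[OF center_in_otri[of False e]] by auto
      then have "(fst l, e) \<in> C" using l by simp
      then show ?thesis using dis[of "(_, e)" "(_, e)"] by (intro ex1I[of _ "fst l"]) auto
    qed
    ultimately have "C \<in> matchings U W" using sub by (auto simp: matchings_def C_def)
    then show ?thesis using TC by blast
  qed
  show ?thesis
    unfolding bij_betw_def
  proof
    show "inj_on ((`) loz) (matchings U W)"
      by (rule inj_onI) (simp only: inj_image_eq_iff[OF inj_loz])
    show "(`) loz ` matchings U W = {T. is_lozenge_tiling R T}"
      using fwd by auto (use bwd in blast)
  qed
qed

section \<open>The hexagon and its holes in terms of unit triangles\<close>

lemma hexagon_eq:
  assumes "0 < M" "M < L" "0 < N"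
  shows "hexagon L M N = {(x, y). 0 \<le> x \<and> x \<le> real L \<and> 0 \<le> y \<and> y \<le> real M + real N \<and>
    real M - real L \<le> y - x \<and> y - x \<le> real N}" (is "_ = ?R")
proof
  have M: "0 < real M" "real M < real L" "0 < real N" using assms by auto
  show "hexagon L M N \<subseteq> ?R"
    unfolding hexagon_def
  proof (rule hull_minimal)
    show "{(0, 0), (real L - real M, 0), (real L, real M), (real L, real M + real N),
      (real M, real M + real N), (0, real N)} \<subseteq> ?R" using M by auto
    have "convex {p :: real \<times> real. c \<le> u * fst p + v * snd p}"
      "convex {p :: real \<times> real. u * fst p + v * snd p \<le> c}" for c u v
      using convex_halfspace_ge[of c "(u, v)"] convex_halfspace_le[of "(u, v)" c]
      by (simp_all add: inner_prod_def)
    from this(1)[of 0 1 0] this(2)[of 1 0 "real L"] this(1)[of 0 0 1] this(2)[of 0 1 "real M + real N"]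
      this(1)[of "real M - real L" "-1" 1] this(2)[of "-1" 1 "real N"]
    have "convex ({p. 0 \<le> fst p} \<inter> {p. fst p \<le> real L} \<inter> {p. 0 \<le> snd p} \<inter> {p. snd p \<le> real M + real N} \<inter>
      {p. real M - real L \<le> snd p - fst p} \<inter> {p. snd p - fst p \<le> real N})"
      by (intro convex_Int) simp_all
    moreover have "?R = {p. 0 \<le> fst p} \<inter> {p. fst p \<le> real L} \<inter> {p. 0 \<le> snd p} \<inter> {p. snd p \<le> real M + real N} \<inter>
      {p. real M - real L \<le> snd p - fst p} \<inter> {p. snd p - fst p \<le> real N}" by auto
    ultimately show "convex ?R" by simp
  qed
  show "?R \<subseteq> hexagon L M N"
  proof
    fix p assume "p \<in> ?R"
    then obtain x y where p: "p = (x, y)" "0 \<le> x" "x \<le> real L" "0 \<le> y" "y \<le> real M + real N"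
      "real M - real L \<le> y - x" "y - x \<le> real N" by auto
    let ?H = "hexagon L M N"
    have c: "convex ?H" by (simp add: hexagon_def)
    have h: "(0, 0) \<in> ?H" "(real L - real M, 0) \<in> ?H" "(real L, real M) \<in> ?H" "(real L, real M + real N) \<in> ?H"
      "(real M, real M + real N) \<in> ?H" "(0, real N) \<in> ?H"
      unfolding hexagon_def by (rule hull_inc, simp)+
    have seg: "P + t *\<^sub>R (P' - P) \<in> ?H" if "P \<in> ?H" "P' \<in> ?H" "0 \<le> t" "t \<le> 1" for P P' t
      using convexD[OF c that(1,2), of "1 - t" t] that by (simp add: algebra_simps)
    \<comment> \<open>The point lies on a vertical segment between the lower and the upper boundary,
      and both endpoints of that segment lie on sides between listed corners.\<close>
    have lo: "(x, max 0 (x - (real L - real M))) \<in> ?H"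
    proof (cases "x \<le> real L - real M")
      case True
      have "x / (real L - real M) * (real L - real M) = x" using M by simp
      then have "(x, max 0 (x - (real L - real M))) = (0, 0) + (x / (real L - real M)) *\<^sub>R ((real L - real M, 0) - (0, 0))"
        using True by simp
      then show ?thesis using seg[OF h(1,2), of "x / (real L - real M)"] True p M by (simp add: divide_le_eq)
    next
      case False
      define t where "t = (x - (real L - real M)) / real M"
      have "t * real M = x - (real L - real M)" using M by (simp add: t_def)
      then have "(x, max 0 (x - (real L - real M))) = (real L - real M, 0) + t *\<^sub>R ((real L, real M) - (real L - real M, 0))"
        using False by simp
      then show ?thesis using seg[OF h(2,3), of t] False p M by (simp add: t_def divide_le_eq)
    qed
    have up: "(x, min (x + real N) (real M + real N)) \<in> ?H"
    proof (cases "x \<le> real M")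
      case True
      have "x / real M * real M = x" using M by simp
      then have "(x, min (x + real N) (real M + real N)) = (0, real N) + (x / real M) *\<^sub>R ((real M, real M + real N) - (0, real N))"
        using True by simp
      then show ?thesis using seg[OF h(6,5), of "x / real M"] True p M by (simp add: divide_le_eq add.commute)
    next
      case False
      define t where "t = (x - real M) / (real L - real M)"
      have "t * (real L - real M) = x - real M" using M by (simp add: t_def)
      then have "(x, min (x + real N) (real M + real N)) = (real M, real M + real N) + t *\<^sub>R ((real L, real M + real N) - (real M, real M + real N))"
        using False by simp
      then show ?thesis using seg[OF h(5,4), of t] False p M by (simp add: t_def divide_le_eq)
    qed
    define l u where "l = max 0 (x - (real L - real M))" and "u = min (x + real N) (real M + real N)"
    have lu: "l \<le> y" "y \<le> u" "l < u \<or> l = u" using p M by (auto simp: l_def u_def)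
    show "p \<in> ?H"
    proof (cases "l = u")
      case True
      then have "y = l" using lu by simp
      then show ?thesis using lo p by (simp add: l_def)
    next
      case False
      define t where "t = (y - l) / (u - l)"
      have "t * (u - l) = y - l" using False by (simp add: t_def)
      then have "p = (x, l) + t *\<^sub>R ((x, u) - (x, l))" using p by simp
      moreover have "0 \<le> t" "t \<le> 1" using lu False by (auto simp: t_def divide_le_eq)
      ultimately show ?thesis using seg[OF lo up, of t] by (simp add: l_def u_def)
    qed
  qed
qed

text \<open>For \<open>a\<close> between 0 and \<open>L\<close>, the heights \<open>b\<close> for
  which the unit segment upwards from \<open>(a, b)\<close> lies in the hexagon.\<close>

definition hexcol :: "nat \<Rightarrow> nat \<Rightarrow> nat \<Rightarrow> int \<Rightarrow> int set" where
  "hexcol L M N a = {b. 0 \<le> b \<and> b < int M + int N \<and> a - int L + int M \<le> b \<and> b < a + int N}"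

text \<open>A large lozenge is made up of lozenges without path step, so the right and left
  triangles that it removes hang at the same segments and one set per column describes both. In
  column \<open>r\<close> each lozenge removes its full interval, and one place fewer with every
  column further away on either side.\<close>

definition holecol :: "nat \<Rightarrow> nat \<Rightarrow> (nat \<Rightarrow> int) \<Rightarrow> int \<Rightarrow> int set" where
  "holecol r q k a = (\<Union>j\<in>{0..q}. {b. k (2 * j + 1) \<le> b \<and> b \<le> k (2 * j) \<and>
     k (2 * j + 1) \<le> b - (a - int r) \<and> b - (a - int r) \<le> k (2 * j)})"

definition redcol :: "nat \<Rightarrow> nat \<Rightarrow> nat \<Rightarrow> nat \<Rightarrow> nat \<Rightarrow> (nat \<Rightarrow> int) \<Rightarrow> int \<Rightarrow> int set" where
  "redcol L M N r q k a = hexcol L M N a - holecol r q k a"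

lemma otri_hexagon_iff:
  assumes "0 < M" "M < L" "0 < N" and p: "p \<in> otri c (a, b)"
  shows "p \<in> hexagon L M N \<longleftrightarrow> (if c then 0 \<le> a \<and> a < int L else 1 \<le> a \<and> a \<le> int L) \<and> b \<in> hexcol L M N a"
proof -
  obtain x y where xy: "p = (x, y)" by (cases p)
  note F = otri_floor[OF p[unfolded xy]]
  have "p \<in> hexagon L M N \<longleftrightarrow> of_int 0 \<le> x \<and> x \<le> of_int (int L) \<and> of_int 0 \<le> y \<and> y \<le> of_int (int M + int N) \<and>
    of_int (int M - int L) \<le> y - x \<and> y - x \<le> of_int (int N)"
    using hexagon_eq[OF assms(1-3)] by (simp add: xy)
  also have "\<dots> \<longleftrightarrow> (if c then 0 \<le> a \<and> a < int L else 1 \<le> a \<and> a \<le> int L) \<and> b \<in> hexcol L M N a"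
    unfolding F hexcol_def by auto
  finally show ?thesis .
qed

lemma otri_large_lozenge_iff:
  assumes "lo \<le> hi" and p: "p \<in> otri c (a, b)"
  shows "p \<in> large_lozenge r lo hi \<longleftrightarrow> lo \<le> b \<and> b \<le> hi \<and> lo \<le> b - (a - int r) \<and> b - (a - int r) \<le> hi"
proof -
  obtain x y where xy: "p = (x, y)" by (cases p)
  note F = otri_floor[OF p[unfolded xy]]
  have "p \<in> large_lozenge r lo hi \<longleftrightarrow> of_int lo \<le> y \<and> y \<le> of_int (hi + 1) \<and>
    of_int (lo - int r) \<le> y - x \<and> y - x \<le> of_int (hi + 1 - int r)"
    using large_lozenge_eq[OF assms(1)] by (simp add: xy)
  also have "\<dots> \<longleftrightarrow> lo \<le> b \<and> b \<le> hi \<and> lo \<le> b - (a - int r) \<and> b - (a - int r) \<le> hi"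
    unfolding F by auto
  finally show ?thesis .
qed

lemma finite_hexcol [simp]: "finite (hexcol L M N a)"
  by (rule finite_subset[of _ "{0..int M + int N}"]) (auto simp: hexcol_def)

lemma finite_redcol [simp]: "finite (redcol L M N r q k a)"
  by (simp add: redcol_def)

lemma hexcol_first: "M < L \<Longrightarrow> hexcol L M N 0 = int ` {0..<N}"
  by (auto simp: hexcol_def image_iff intro!: bexI[of _ "nat _"])

lemma hexcol_last: "M < L \<Longrightarrow> hexcol L M N (int L) = (\<lambda>j. int (M + j)) ` {0..<N}"
  by (auto simp: hexcol_def image_iff intro!: bexI[of _ "nat (_ - int M)"])

lemma closed_large_lozenge: "closed (large_lozenge r a b)"
  unfolding large_lozenge_def Let_def
  by (intro compact_imp_closed finite_imp_compact_convex_hull) simp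

lemma closure_reduced_hexagon:
  assumes "0 < M" "M < L" "0 < N" and k: "\<And>j. j \<le> q \<Longrightarrow> k (2 * j + 1) \<le> k (2 * j)"
  shows "closure (reduced_hexagon L M N r q k) =
    (\<Union>e\<in>{(a, b). 0 \<le> a \<and> a < int L \<and> b \<in> redcol L M N r q k a}. ctri True e) \<union>
    (\<Union>e\<in>{(a, b). 1 \<le> a \<and> a \<le> int L \<and> b \<in> redcol L M N r q k a}. ctri False e)"
    (is "closure ?R = (\<Union>e\<in>?U. ctri True e) \<union> (\<Union>e\<in>?W. ctri False e)")
proof
  let ?S = "(\<Union>e\<in>?U. ctri True e) \<union> (\<Union>e\<in>?W. ctri False e)"
  let ?H = "hexagon L M N" and ?LL = "\<Union>j\<in>{0..q}. large_lozenge r (k (2 * j + 1)) (k (2 * j))"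
  have LL: "p \<in> ?LL \<longleftrightarrow> b \<in> holecol r q k a" if "p \<in> otri c (a, b)" for p c a b
    using otri_large_lozenge_iff[OF k that, of _ r] by (auto simp: holecol_def)
  have R: "p \<in> ?R \<longleftrightarrow> (if c then (a, b) \<in> ?U else (a, b) \<in> ?W)" if "p \<in> otri c (a, b)" for p c a b
    using otri_hexagon_iff[OF assms(1-3) that] LL[OF that]
    unfolding reduced_hexagon_def redcol_def by auto
  show "?S \<subseteq> closure ?R"
  proof -
    have "ctri c (a, b) \<subseteq> closure ?R" if "if c then (a, b) \<in> ?U else (a, b) \<in> ?W" for c a b
    proof -
      have "otri c (a, b) \<subseteq> ?R" using R that by blast
      then show ?thesis using ctri_subset_closure_otri closure_mono by blast
    qed
    from this[of True] this[of False] show ?thesis by (simp del: ctri.simps) blast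
  qed
  have fin: "finite ?U" "finite ?W"
    by (rule finite_subset[of _ "Sigma {0..int L} (redcol L M N r q k)"]; auto)+
  have clS: "closed ?S"
    using fin by (intro closed_Un closed_UN ballI closed_ctri)
  have clLL: "closed ?LL"
    by (intro closed_UN ballI closed_large_lozenge) simp
  have cvx: "convex ?H" and clH: "closed ?H"
    unfolding hexagon_def by (auto intro!: compact_imp_closed finite_imp_compact_convex_hull)
  \<comment> \<open>A point of the reduced hexagon may lie on the boundary of the hexagon, where
    neighbourhoods leave it. Since the hexagon is the closure of its interior, a nearby interior
    point can be used instead.\<close>
  have "otri True (0, 0) \<subseteq> ?H"
    using otri_hexagon_iff[OF assms(1-3), of _ True 0 0] assms by (auto simp: hexcol_def)
  then have "otri True (0, 0) \<subseteq> interior ?H" by (intro interior_maximal open_otri)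
  then have "interior ?H \<noteq> {}" using center_in_otri[of True "(0, 0)"] by blast
  from convex_closure_interior[OF cvx this] have H: "closure (interior ?H) = ?H"
    using clH by (simp add: closure_closed)
  show "closure ?R \<subseteq> ?S"
  proof (rule closure_minimal[OF _ clS], rule ccontr)
    assume "\<not> ?R \<subseteq> ?S"
    then obtain p where p: "p \<in> ?R" "p \<notin> ?S" by blast
    define A where "A = - ?S \<inter> - ?LL"
    have A: "open A" unfolding A_def using clS clLL by (intro open_Int open_Compl)
    have "p \<in> A" using p by (simp add: reduced_hexagon_def A_def)
    moreover have "p \<in> closure (interior ?H)" using p H by (simp add: reduced_hexagon_def)
    ultimately have "A \<inter> interior ?H \<noteq> {}"
      using open_Int_closure_eq_empty[OF A] by blast
    then obtain w where w: "w \<in> A \<inter> interior ?H" by blast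
    have "open (A \<inter> interior ?H)" using A by (intro open_Int open_interior)
    from open_meets_otri[OF this w] obtain c a b v where v: "v \<in> otri c (a, b)" "v \<in> A" "v \<in> interior ?H"
      by (metis IntE prod.collapse)
    from v(3) have "v \<in> ?H" using interior_subset by (rule rev_subsetD)
    then have "v \<in> ?R" using v(2) unfolding reduced_hexagon_def A_def by simp
    then have "if c then (a, b) \<in> ?U else (a, b) \<in> ?W" using R[OF v(1)] by simp
    moreover have "v \<in> ctri c (a, b)" using v(1) otri_subset_ctri by blast
    ultimately have "v \<in> ?S" by (cases c) (simp_all only: if_True if_False, blast+)
    moreover have "v \<notin> ?S" using v(2) unfolding A_def Int_iff Compl_iff by (rule conjunct1)
    ultimately show False by (rule rev_notE)
  qed
qed

lemma G_eq_path_families: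
  assumes "0 < M" "M < L" "0 < N" "1 \<le> r" "r < L"
    and k: "\<And>j. j \<le> q \<Longrightarrow> k (2 * j + 1) \<le> k (2 * j)"
    and size: "\<And>j. j \<le> q \<Longrightarrow> k (2 * j) - k (2 * j + 1) < min (int r) (int L - int r)"
  shows "G L M N r q k = path_families N (redcol L M N r q k) int L (\<lambda>j. int (M + j))"
proof -
  let ?Y = "redcol L M N r q k"
  let ?t = "\<lambda>j. int (M + j)"
  \<comment> \<open>A large lozenge meets a segment of column 0 or \<open>L\<close> only if its
    interval has more than \<open>r\<close> or \<open>L - r\<close> places, respectively.\<close>
  have "b \<notin> holecol r q k 0" for b using size by (fastforce simp: holecol_def)
  then have Y0: "?Y 0 = int ` {0..<N}" using hexcol_first[OF assms(2)] by (auto simp: redcol_def)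
  have "b \<notin> holecol r q k (int L)" for b using size by (fastforce simp: holecol_def)
  then have YL: "?Y (int L) = ?t ` {0..<N}" using hexcol_last[OF assms(2)] by (auto simp: redcol_def)
  have U: "{(a, b). 0 \<le> a \<and> a < int L \<and> b \<in> ?Y a} = srcs ?Y L"
    by (simp add: srcs_def)
  have W: "{(a, b). 1 \<le> a \<and> a \<le> int L \<and> b \<in> ?Y a} = tgts ?Y L (?t ` {0..<N})"
    using assms(2) unfolding YL[symmetric] by (auto simp: tgts_def order_le_less)
  have "bij_betw ((`) loz) (matchings {(a, b). 0 \<le> a \<and> a < int L \<and> b \<in> ?Y a} {(a, b). 1 \<le> a \<and> a \<le> int L \<and> b \<in> ?Y a})
      {T. is_lozenge_tiling (reduced_hexagon L M N r q k) T}"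
    by (intro tilings_bij_matchings closure_reduced_hexagon assms)
  then have "G L M N r q k = card (matchings (srcs ?Y L) (tgts ?Y L (?t ` {0..<N})))"
    unfolding G_def U W by (rule bij_betw_same_card[symmetric])
  also have "\<dots> = card (partial_tilings N ?Y L ?t)" using assms(2) by (simp add: partial_tilings_def)
  also have "\<dots> = path_families N ?Y int L ?t"
    using Y0 by (intro card_partial_tilings) (auto simp: strict_mono_on_def)
  finally show ?thesis .
qed

section \<open>The determinant of the reduced hexagon\<close>

definition avoid :: "int set \<Rightarrow> 'a::comm_ring_1 poly \<Rightarrow> 'a poly" where
  "avoid I p = (\<Sum>l\<le>degree p. monom (if int l \<in> I then 0 else coeff p l) l)"

lemma coeff_avoid: "coeff (avoid I p) l = (if int l \<in> I then 0 else coeff p l)"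
proof -
  have "coeff (avoid I p) l = (\<Sum>i\<le>degree p. if i = l then (if int l \<in> I then 0 else coeff p l) else 0)"
    unfolding avoid_def coeff_sum by (intro sum.cong) auto
  also have "\<dots> = (if int l \<in> I then 0 else coeff p l)"
    by (auto simp: coeff_eq_0)
  finally show ?thesis .
qed

lemma avoid_0 [simp]: "avoid I 0 = 0"
  by (rule poly_eqI) (simp add: coeff_avoid)

lemma avoid_add: "avoid I (p + q) = avoid I p + avoid I q"
  by (rule poly_eqI) (simp add: coeff_avoid)

lemma avoid_smult: "avoid I (Polynomial.smult c p) = Polynomial.smult c (avoid I p)"
  by (rule poly_eqI) (simp add: coeff_avoid)

lemma avoid_sum: "avoid I (\<Sum>i\<in>S. f i) = (\<Sum>i\<in>S. avoid I (f i))"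
  by (induction S rule: infinite_finite_induct) (auto simp: avoid_add)

text \<open>Heights are integers; extending the coefficients by 0 makes Pascal's recursion hold
  without exception at 0.\<close>

definition icoeff :: "'a::comm_ring_1 poly \<Rightarrow> int \<Rightarrow> 'a" where
  "icoeff p m = (if m < 0 then 0 else coeff p (nat m))"

lemma icoeff_mult_1_z: "icoeff ([:1, 1:] * p) m = icoeff p m + icoeff p (m - 1)"
proof (cases "m \<le> 0")
  case True
  then show ?thesis by (cases "m = 0") (auto simp: icoeff_def)
next
  case False
  then obtain l where "m = int (Suc l)" using zero_less_imp_eq_int[of m] by (metis gr0_conv_Suc not_le)
  then show ?thesis by (simp add: icoeff_def nat_add_distrib)
qed

lemma icoeff_avoid: "icoeff (avoid I p) m = of_bool (m \<notin> I) * icoeff p m"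
  by (auto simp: icoeff_def coeff_avoid)

lemma path_count_free:
  assumes "0 \<le> s i" and "\<And>a. 0 \<le> a \<Longrightarrow> a < int n \<Longrightarrow> Y a = UNIV"
  shows "path_count Y s n m i = icoeff ([:1, 1:] ^ n * monom 1 (nat (s i))) m"
  using assms(2)
proof (induction n arbitrary: m)
  case 0
  then show ?case using assms(1) by (auto simp: icoeff_def)
next
  case (Suc n)
  then show ?case by (simp add: icoeff_mult_1_z mult.assoc del: mult_pCons_left)
qed

text \<open>Each factor \<open>1 + z\<close> is one step. The filter of column \<open>r\<close> acts
  in the step from \<open>r\<close> to \<open>r + 1\<close>, so the formula starts at column
  \<open>r + 1\<close>; hence \<open>Suc d\<close>.\<close>

lemma path_count_filter_once:
  assumes Y: "\<And>a. Y a = (if a = int r then - I else UNIV)" and "0 \<le> s i"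
  shows "(path_count Y s (r + Suc d) m i :: 'a::comm_ring_1) =
    icoeff ([:1, 1:] ^ Suc d * avoid I ([:1, 1:] ^ r * monom 1 (nat (s i)))) m"
proof (induction d arbitrary: m)
  case 0
  have "path_count Y s r m i = icoeff ([:1, 1:] ^ r * monom (1 :: 'a) (nat (s i))) m" for m
    using assms by (intro path_count_free) auto
  moreover have "Y (int r) = - I" using assms by simp
  ultimately show ?case by (simp add: icoeff_mult_1_z icoeff_avoid del: mult_pCons_left)
next
  case (Suc d)
  have "(path_count Y s (r + Suc (Suc d)) m i :: 'a) = path_count Y s (r + Suc d) m i + path_count Y s (r + Suc d) (m - 1) i"
    by (simp add: Y)
  also have "\<dots> = icoeff ([:1, 1:] ^ Suc (Suc d) * avoid I ([:1, 1:] ^ r * monom 1 (nat (s i)))) m"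
    unfolding Suc power_Suc[of _ "Suc d"] mult.assoc icoeff_mult_1_z ..
  finally show ?case .
qed

lemma path_count_range:
  assumes "s i \<ge> 0" "s i < int N" "m < 0 \<or> int n + int N \<le> m"
  shows "path_count Y s n m i = 0"
  using assms(3)
proof (induction n arbitrary: m)
  case 0
  then show ?case using assms by auto
next
  case (Suc n)
  then show ?case by auto
qed

text \<open>Only the constraint in column \<open>r\<close> matters: a path that avoids the holes there and ends in the last
  column enters neither the large lozenges nor the outside of the hexagon.\<close>

lemma path_count_redcol:
  fixes r q :: nat and k :: "nat \<Rightarrow> int"
  defines "Y' \<equiv> \<lambda>a. if a = int r then - holecol r q k (int r) else UNIV"
  assumes i: "i < N" and M: "M < L"
    and n: "n \<le> L" "m \<in> redcol L M N r q k (int n)"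
  shows "(path_count (redcol L M N r q k) int n m i :: 'a::comm_ring_1) = path_count Y' int n m i"
  using n
proof (induction n arbitrary: m)
  case 0
  then show ?case by simp
next
  case (Suc n)
  let ?Y = "redcol L M N r q k"
  \<comment> \<open>In a column after \<open>r\<close>, both predecessors of a hole place are hole
    places. A path ending there would have had to pass the filter of column
    \<open>r\<close>.\<close>
  have hole: "of_bool (m \<in> Y' (int n)) * path_count Y' int n m i = (0 :: 'a)"
    if "m \<in> holecol r q k (int n)" "r \<le> n" for m n
    using that
  proof (induction n arbitrary: m)
    case 0
    then show ?case by (simp add: Y'_def)
  next
    case (Suc n)
    show ?case
    proof (cases "Suc n = r")
      case True
      then show ?thesis using Suc by (simp add: Y'_def)
    next
      case False
      then have "r \<le> n" using Suc by simp
      moreover from Suc.prems(1) obtain j where "j \<in> {0..q}" "k (2 * j + 1) \<le> m" "m \<le> k (2 * j)"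
        "k (2 * j + 1) \<le> m - (int (Suc n) - int r)" "m - (int (Suc n) - int r) \<le> k (2 * j)"
        by (auto simp: holecol_def)
      then have "m \<in> holecol r q k (int n)" "m - 1 \<in> holecol r q k (int n)"
        using \<open>r \<le> n\<close> by (auto simp: holecol_def intro!: bexI[of _ j])
      ultimately show ?thesis using Suc.IH by simp
    qed
  qed
  have "of_bool (m' \<in> ?Y (int n)) * path_count ?Y int n m' i = of_bool (m' \<in> Y' (int n)) * (path_count Y' int n m' i :: 'a)"
    if m': "m' = m \<or> m' = m - 1" for m'
  proof (cases "m' \<in> ?Y (int n)")
    case True
    then have "m' \<in> Y' (int n)" by (auto simp: Y'_def redcol_def)
    moreover have "path_count ?Y int n m' i = (path_count Y' int n m' i :: 'a)"
      using Suc.IH Suc.prems True by simp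
    ultimately show ?thesis using True by simp
  next
    case False
    have "of_bool (m' \<in> Y' (int n)) * path_count Y' int n m' i = (0 :: 'a)"
    proof (cases "m' \<in> hexcol L M N (int n)")
      case True
      then have h: "m' \<in> holecol r q k (int n)" using False by (simp add: redcol_def)
      \<comment> \<open>Before column \<open>r\<close> both successors of a hole place are hole
        places, whereas the successor \<open>m\<close> is not one.\<close>
      have "r \<le> n"
      proof (rule ccontr)
        assume "\<not> r \<le> n"
        moreover from h obtain j where "j \<in> {0..q}" "k (2 * j + 1) \<le> m'" "m' \<le> k (2 * j)"
          "k (2 * j + 1) \<le> m' - (int n - int r)" "m' - (int n - int r) \<le> k (2 * j)"
          by (auto simp: holecol_def)
        ultimately have "m \<in> holecol r q k (int (Suc n))"
          using m' by (auto simp: holecol_def intro!: bexI[of _ j])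
        then show False using Suc.prems by (simp add: redcol_def)
      qed
      then show ?thesis by (rule hole[OF h])
    next
      case False
      \<comment> \<open>The successor \<open>m\<close> rules out that \<open>m'\<close> lies beyond
        the top or the lower right side. Beyond the other two sides no path from the starting points
        arrives.\<close>
      then have "m' < 0 \<or> int n + int N \<le> m'"
        using m' Suc.prems by (auto simp: redcol_def hexcol_def)
      then show ?thesis using i by (simp add: path_count_range)
    qed
    then show ?thesis using False by simp
  qed
  from this[of m] this[of "m - 1"] show ?case by simp
qed

text \<open>The first form is for the rank-one update, the second for proving that the count is not
  zero.\<close>

lemma G_eq_det:
  assumes "0 < M" "M < L" "0 < N" "1 \<le> r" "r < L"
    and k: "\<And>j. j \<le> q \<Longrightarrow> k (2 * j + 1) \<le> k (2 * j)"
    and size: "\<And>j. j \<le> q \<Longrightarrow> k (2 * j) - k (2 * j + 1) < min (int r) (int L - int r)"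
  shows "(of_nat (G L M N r q k) :: 'a::comm_ring_1) = Determinant.det (Matrix.mat N N (\<lambda>(j, i).
      coeff ([:1, 1:] ^ (L - r) * avoid (holecol r q k (int r)) ([:1, 1:] ^ r * monom 1 i)) (M + j)))"
    (is "_ = Determinant.det ?A")
    and "(of_nat (G L M N r q k) :: 'a) =
      of_nat (path_families N (\<lambda>a. if a = int r then - holecol r q k (int r) else UNIV) int L (\<lambda>j. int (M + j)))"
    (is "_ = of_nat ?w")
proof -
  let ?Y = "redcol L M N r q k" and ?t = "\<lambda>j. int (M + j)"
  let ?Y' = "\<lambda>a. if a = int r then - holecol r q k (int r) else UNIV"
  have mono: "strict_mono_on {0..<N} int" "strict_mono_on {0..<N} ?t"
    by (auto simp: strict_mono_on_def)
  have "b \<notin> holecol r q k (int L)" for b using size by (fastforce simp: holecol_def)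
  then have YL: "?t j \<in> ?Y (int L)" if "j < N" for j
    using that assms(2) by (auto simp: redcol_def hexcol_def)
  have "(of_nat (G L M N r q k) :: 'a) = Determinant.det (Matrix.mat N N (\<lambda>(j, i). path_count ?Y int L (?t j) i))"
    using G_eq_path_families[of M L N r q k, OF assms] unfolding det_path_count_eq_path_families[OF mono] by simp
  also have A: "Matrix.mat N N (\<lambda>(j, i). path_count ?Y int L (?t j) i) = Matrix.mat N N (\<lambda>(j, i). path_count ?Y' int L (?t j) i :: 'a)"
    using YL assms(2) by (intro eq_matI) (auto intro!: path_count_redcol)
  finally show "(of_nat (G L M N r q k) :: 'a) = of_nat ?w"
    unfolding det_path_count_eq_path_families[OF mono] .
  obtain d where d: "L = r + Suc d" using assms(5) less_iff_Suc_add by auto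
  have "path_count ?Y' int L (?t j) i = coeff ([:1, 1:] ^ (L - r) * avoid (holecol r q k (int r)) ([:1, 1:] ^ r * monom (1::'a) i)) (M + j)" for i j
  proof -
    have "path_count ?Y' int (r + Suc d) (?t j) i =
      icoeff ([:1, 1:] ^ Suc d * avoid (holecol r q k (int r)) ([:1, 1:] ^ r * monom (1::'a) (nat (int i)))) (?t j)"
      by (rule path_count_filter_once) auto
    then show ?thesis unfolding d by (simp add: icoeff_def nat_add_distrib del: power_Suc)
  qed
  then have "Matrix.mat N N (\<lambda>(j, i). path_count ?Y' int L (?t j) i) = ?A"
    by (intro eq_matI) auto
  then show "(of_nat (G L M N r q k) :: 'a) = Determinant.det ?A"
    using \<open>of_nat (G L M N r q k) = Determinant.det _\<close> unfolding A by simp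
qed

section \<open>Explicit path families\<close>

lemma strict_mono_on_int_diff:
  fixes s :: "nat \<Rightarrow> int"
  assumes "strict_mono_on {0..<N} s" "i \<le> j" "j < N"
  shows "int (j - i) \<le> s j - s i"
  using assms(2,3)
proof (induction j rule: dec_induct)
  case (step n)
  then have "s n < s (Suc n)" using assms(1) by (auto simp: strict_mono_on_def)
  then show ?case using step by simp
qed simp

lemma strict_mono_enumeration:
  fixes S :: "int set"
  assumes "finite S" "card S = N"
  obtains s where "strict_mono_on {0..<N} s" "s ` {0..<N} = S"
proof
  show "strict_mono_on {0..<N} (\<lambda>j. sorted_list_of_set S ! j)"
    using assms strict_sorted_list_of_set[of S] by (auto simp: strict_mono_on_def sorted_wrt_iff_nth_less)
  show "(\<lambda>j. sorted_list_of_set S ! j) ` {0..<N} = S"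
    using assms nth_image[of N "sorted_list_of_set S"] by simp
qed

text \<open>The hexagon bounds the outermost places and neighbours differ by at least 1. The bounds
  say that path \<open>j\<close> can get from \<open>(0, j)\<close> to \<open>(r, s j)\<close> and
  from there to \<open>(L, M + j)\<close>.\<close>

lemma hexcol_enum_bounds:
  assumes s: "strict_mono_on {0..<N} s" "s ` {0..<N} \<subseteq> hexcol L M N (int r)" and j: "j < N"
  shows "int j \<le> s j" "s j \<le> int r + int j" "s j \<le> int M + int j" "int r - int L + int M + int j \<le> s j"
proof -
  have "s 0 \<in> hexcol L M N (int r)" "s (N - 1) \<in> hexcol L M N (int r)" using s(2) j by auto
  moreover have "int (j - 0) \<le> s j - s 0" using strict_mono_on_int_diff[OF s(1)] j by blast
  moreover have "int (N - 1 - j) \<le> s (N - 1) - s j" using strict_mono_on_int_diff[OF s(1), of j "N - 1"] j by simp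
  ultimately show "int j \<le> s j" "s j \<le> int r + int j" "s j \<le> int M + int j" "int r - int L + int M + int j \<le> s j"
    using j by (auto simp: hexcol_def)
qed

text \<open>Every path rises as early as possible and then stays at its final height. The minimum of
  two strictly increasing sequences is again strictly increasing.\<close>

lemma path_families_free_pos:
  assumes s: "strict_mono_on {0..<N} s" and t: "strict_mono_on {0..<N} t"
    and st: "\<And>j. j < N \<Longrightarrow> s j \<le> t j \<and> t j \<le> s j + int n"
  shows "0 < path_families N (\<lambda>_. UNIV) s n t"
proof (rule path_families_pos[where x = "\<lambda>m j. min (s j + int m) (t j)"])
  show "strict_mono_on {0..<N} (\<lambda>j. min (s j + int m) (t j))" for m
  proof (rule strict_mono_onI)
    fix i j assume "i \<in> {0..<N}" "j \<in> {0..<N}" "i < j"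
    then have "s i < s j" "t i < t j" using s t by (auto simp: strict_mono_on_def)
    then show "min (s i + int m) (t i) < min (s j + int m) (t j)" by linarith
  qed
qed (use st in auto)

text \<open>The early-rising family is used twice: up to the \<open>N\<close> free places
  \<open>s\<close> of column \<open>r\<close>, and from there to the end.\<close>

lemma path_families_through_pos:
  assumes s: "strict_mono_on {0..<N} s" "s ` {0..<N} \<subseteq> hexcol L M N (int r) - I" and "r < L"
  shows "0 < path_families N (\<lambda>a. if a = int r then - I else UNIV) int L (\<lambda>j. int (M + j))"
proof (rule path_families_pos[where x = "\<lambda>m j. if m \<le> r then min (int j + int m) (s j) else min (s j + int (m - r)) (int (M + j))"])
  have b: "int j \<le> s j" "s j \<le> int r + int j" "s j \<le> int M + int j" "int r - int L + int M + int j \<le> s j"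
    if "j < N" for j
    using hexcol_enum_bounds[OF s(1) _ that, of L M r] s(2) by auto
  have sI: "s j \<notin> I" if "j < N" for j using s(2) that by (auto simp: image_subset_iff)
  show "strict_mono_on {0..<N} (\<lambda>j. if m \<le> r then min (int j + int m) (s j) else min (s j + int (m - r)) (int (M + j)))" for m
  proof (rule strict_mono_onI)
    fix i j assume "i \<in> {0..<N}" "j \<in> {0..<N}" "i < j"
    then have "s i < s j" using s(1) by (auto simp: strict_mono_on_def)
    then show "(if m \<le> r then min (int i + int m) (s i) else min (s i + int (m - r)) (int (M + i)))
      < (if m \<le> r then min (int j + int m) (s j) else min (s j + int (m - r)) (int (M + j)))"
      using \<open>i < j\<close> by (simp add: min_def)
  qed
  fix j assume j: "j < N"
  note b = b[OF j]
  show "(if 0 \<le> r then min (int j + int 0) (s j) else min (s j + int (0 - r)) (int (M + j))) = int j"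
    using b by simp
  show "int (M + j) = (if L \<le> r then min (int j + int L) (s j) else min (s j + int (L - r)) (int (M + j)))"
    using b \<open>r < L\<close> by (auto simp: min_def)
  fix m assume "m < L"
  show "(if Suc m \<le> r then min (int j + int (Suc m)) (s j) else min (s j + int (Suc m - r)) (int (M + j))) -
      (if m \<le> r then min (int j + int m) (s j) else min (s j + int (m - r)) (int (M + j))) \<in> {0, 1}"
    using b by (auto simp: min_def)
  show "(if m \<le> r then min (int j + int m) (s j) else min (s j + int (m - r)) (int (M + j)))
      \<in> (if int m = int r then - I else UNIV)"
  proof (cases "m = r")
    case True
    have "min (int j + int r) (s j) = s j" using b by simp
    then show ?thesis using sI[OF j] True by simp
  qed simp
qed

section \<open>Determinants of rank-one perturbations\<close>

lemma det_rows_scale: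
  fixes A :: "nat \<Rightarrow> nat \<Rightarrow> 'a::comm_ring_1"
  shows "Determinant.det (Matrix.mat N N (\<lambda>(j, i). c j * A j i)) =
    (\<Prod>j=0..<N. c j) * Determinant.det (Matrix.mat N N (\<lambda>(j, i). A j i))"
  unfolding det_mat_perm by (simp add: prod.distrib sum_distrib_left mult_ac)

text \<open>In the expansion by rows, two perturbed rows are both multiples of \<open>v\<close>, so
  only the empty set and the singletons contribute.\<close>

lemma det_one_minus_rank_one:
  fixes p v :: "nat \<Rightarrow> 'a::comm_ring_1"
  shows "Determinant.det (Matrix.mat N N (\<lambda>(j, i). of_bool (j = i) - p j * v i)) = 1 - (\<Sum>i<N. p i * v i)"
proof -
  define T where "T E = Determinant.det (Matrix.mat N N (\<lambda>(j, i). if j \<in> E then - p j * v i else of_bool (j = i)))" for E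
  have T_empty: "T {} = 1"
  proof -
    have "T {} = Determinant.det (1\<^sub>m N :: 'a mat)"
      unfolding T_def by (intro arg_cong[where f = Determinant.det] eq_matI) auto
    then show ?thesis by simp
  qed
  have T_single: "T {j} = - p j * v j" if j: "j < N" for j
  proof -
    have "T {j} = (\<Sum>\<pi>\<in>{\<pi>. \<pi> permutes {0..<N}}. if \<pi> = id then - p j * v j else 0)"
      unfolding T_def det_mat_perm
    proof (rule sum.cong[OF refl])
      fix \<pi> assume "\<pi> \<in> {\<pi>. \<pi> permutes {0..<N}}"
      then have \<pi>: "\<pi> permutes {0..<N}" by simp
      show "signof \<pi> * (\<Prod>i=0..<N. if i \<in> {j} then - p i * v (\<pi> i) else of_bool (i = \<pi> i)) =
        (if \<pi> = id then - p j * v j else 0)"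
      proof (cases "\<forall>i<N. i \<noteq> j \<longrightarrow> \<pi> i = i")
        case True
        have fix1: "\<pi> i = i" if "i \<noteq> j" for i
          using True that permutes_not_in[OF \<pi>, of i] by (cases "i < N") auto
        then have "\<pi> j = j" using permutes_inj[OF \<pi>] by (metis injD)
        with fix1 have "\<pi> x = id x" for x by (cases "x = j") auto
        then have id: "\<pi> = id" by (rule ext)
        have "(\<Prod>i=0..<N. if i \<in> {j} then - p i * v (\<pi> i) else of_bool (i = \<pi> i)) =
          (\<Prod>i=0..<N. if i = j then - p j * v j else 1)"
          by (intro prod.cong) (auto simp: id)
        also have "\<dots> = - p j * v j" using j by simp
        finally show ?thesis by (simp add: id)
      next
        case False
        then obtain i where "i < N" "i \<noteq> j" "\<pi> i \<noteq> i" by blast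
        then have "(\<Prod>i=0..<N. if i \<in> {j} then - p i * v (\<pi> i) else of_bool (i = \<pi> i)) = 0"
          by (intro prod_zero bexI[of _ i]) auto
        moreover have "\<pi> \<noteq> id" using \<open>\<pi> i \<noteq> i\<close> by auto
        ultimately show ?thesis by simp
      qed
    qed
    also have "\<dots> = - p j * v j"
      by (subst sum.delta) (auto simp: finite_permutations permutes_id)
    finally show ?thesis .
  qed
  have T_zero: "T E = 0" if "j \<in> E" "j' \<in> E" "j \<noteq> j'" "E \<subseteq> {0..<N}" for E j j'
  proof -
    have "T E = Determinant.det (Matrix.mat N N (\<lambda>(j, i). (if j \<in> E then - p j else 1) * (if j \<in> E then v i else of_bool (j = i))))"
      unfolding T_def by (intro arg_cong[where f = Determinant.det] eq_matI) auto
    also have "\<dots> = 0"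
      unfolding det_rows_scale using that
      by (subst det_equal_rows[of j N j']) auto
    finally show ?thesis .
  qed
  have "Determinant.det (Matrix.mat N N (\<lambda>(j, i). of_bool (j = i) - p j * v i)) =
    Determinant.det (Matrix.mat N N (\<lambda>(j, i). - p j * v i + of_bool (j = i)))"
    by (simp add: algebra_simps)
  also have "\<dots> = (\<Sum>E\<in>Pow {0..<N}. T E)"
    unfolding det_rows_add_expand T_def ..
  also have "\<dots> = (\<Sum>E\<in>insert {} ((\<lambda>j. {j}) ` {0..<N}). T E)"
  proof (rule sum.mono_neutral_right)
    show "\<forall>E\<in>Pow {0..<N} - insert {} ((\<lambda>j. {j}) ` {0..<N}). T E = 0"
    proof
      fix E assume E: "E \<in> Pow {0..<N} - insert {} ((\<lambda>j. {j}) ` {0..<N})"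
      then obtain j where j: "j \<in> E" by auto
      then have "E \<noteq> {j}" using E by auto
      then obtain j' where "j' \<in> E" "j \<noteq> j'" using j by auto
      then show "T E = 0" using T_zero[OF j] E by auto
    qed
  qed auto
  also have "\<dots> = T {} + (\<Sum>E\<in>(\<lambda>j. {j}) ` {0..<N}. T E)" by (subst sum.insert) auto
  also have "(\<Sum>E\<in>(\<lambda>j. {j}) ` {0..<N}. T E) = (\<Sum>j=0..<N. T {j})"
    by (subst sum.reindex) auto
  also have "\<dots> = (\<Sum>j=0..<N. - (p j * v j))" by (intro sum.cong) (auto simp: T_single)
  finally show ?thesis by (simp add: T_empty sum_negf atLeast0LessThan)
qed

lemma det_nonzero_kernel:
  fixes A :: "nat \<Rightarrow> nat \<Rightarrow> 'a::field"
  assumes "Determinant.det (Matrix.mat N N (\<lambda>(j, i). A j i)) \<noteq> 0"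
    and "\<And>j. j < N \<Longrightarrow> (\<Sum>i<N. A j i * c i) = 0" and "i < N"
  shows "c i = 0"
proof -
  let ?M = "Matrix.mat N N (\<lambda>(j, i). A j i)" and ?v = "Matrix.vec N c"
  have "?M *\<^sub>v ?v = 0\<^sub>v N"
    by (rule eq_vecI) (use assms(2) in \<open>auto simp: scalar_prod_def atLeast0LessThan\<close>)
  then have "?v = 0\<^sub>v N"
    using det_0_iff_vec_prod_zero_field[of ?M N] assms(1) by (metis mat_carrier vec_carrier)
  then have "Matrix.vec_index ?v i = Matrix.vec_index (0\<^sub>v N) i" by simp
  then show ?thesis using assms(3) by simp
qed

section \<open>The rank-one update\<close>

text \<open>Since \<open>u = A p\<close>, the updated matrix factors as
  \<open>A (1 - p v^T)\<close>. This covers singular \<open>A\<close>, that is, the case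
  \<open>G = 0\<close>.\<close>

lemma det_rank_one_update:
  fixes A :: "nat \<Rightarrow> nat \<Rightarrow> 'a::comm_ring_1"
  assumes u: "\<And>j. j < N \<Longrightarrow> (\<Sum>i<N. A j i * p i) = u j"
  shows "Determinant.det (Matrix.mat N N (\<lambda>(j, i). A j i - u j * v i)) =
    Determinant.det (Matrix.mat N N (\<lambda>(j, i). A j i)) * (1 - (\<Sum>i<N. p i * v i))"
proof -
  let ?A = "Matrix.mat N N (\<lambda>(j, i). A j i)" and ?B = "Matrix.mat N N (\<lambda>(j, i). of_bool (j = i) - p j * v i)"
  have "Matrix.mat N N (\<lambda>(j, i). A j i - u j * v i) = ?A * ?B"
  proof (rule eq_matI)
    fix j i assume "j < dim_row (?A * ?B)" "i < dim_col (?A * ?B)"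
    then have ji: "j < N" "i < N" by auto
    have "(?A * ?B) $$ (j, i) = (\<Sum>l=0..<N. A j l * (of_bool (l = i) - p l * v i))"
      using ji by (simp add: scalar_prod_def)
    also have "\<dots> = (\<Sum>l=0..<N. if l = i then A j l else 0) - (\<Sum>l=0..<N. A j l * p l) * v i"
      unfolding sum_distrib_right sum_subtractf[symmetric]
      by (intro sum.cong) (auto simp: algebra_simps)
    also have "\<dots> = A j i - u j * v i"
      using ji u[OF ji(1)] by (simp add: atLeast0LessThan)
    finally show "Matrix.mat N N (\<lambda>(j, i). A j i - u j * v i) $$ (j, i) = (?A * ?B) $$ (j, i)"
      using ji by simp
  qed auto
  then show ?thesis
    by (simp add: det_mult[of _ N] det_one_minus_rank_one)
qed

text \<open>The independence needed when column \<open>r\<close> has too few free places. Within the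
  window only the coefficients of \<open>H\<close> at the \<open>N\<close> places of
  \<open>S\<close> matter, and they form a kernel vector of the matrix of path counts from these
  places to the last column. Its determinant is a positive number of path families, nonzero in
  characteristic 0.\<close>

lemma coeff_zero_of_window_zero:
  fixes H :: "'a::field_char_0 poly"
  assumes "0 < M" "M < L" "0 < N" "r < L"
    and S: "S \<subseteq> hexcol L M N (int r)" "card S = N"
    and H: "\<And>l. int l \<in> hexcol L M N (int r) \<Longrightarrow> int l \<notin> S \<Longrightarrow> coeff H l = 0"
      "\<And>l. r + N \<le> l \<Longrightarrow> coeff H l = 0"
    and window: "\<And>j. j < N \<Longrightarrow> coeff ([:1, 1:] ^ (L - r) * H) (M + j) = 0"
    and l: "int l \<in> S"
  shows "coeff H l = 0"
proof -
  let ?E = "[:1, 1:] ^ (L - r) :: 'a poly"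
  have "finite S" by (rule finite_subset[OF S(1)]) simp
  then obtain s where s: "strict_mono_on {0..<N} s" "s ` {0..<N} = S"
    using strict_mono_enumeration[OF _ S(2)] by metis
  have b: "int j \<le> s j" "s j \<le> int r + int j" "s j \<le> int M + int j" "int r - int L + int M + int j \<le> s j"
    if "j < N" for j
    using hexcol_enum_bounds[OF s(1) _ that, of L M r] s(2) S(1) by auto
  have spos: "0 \<le> s j" if "j < N" for j using b(1)[OF that] by simp
  have "0 < path_families N (\<lambda>_. UNIV) s (L - r) (\<lambda>j. int (M + j))"
  proof (intro path_families_free_pos s(1))
    show "s j \<le> int (M + j) \<and> int (M + j) \<le> s j + int (L - r)" if "j < N" for j
      using b[OF that] \<open>r < L\<close> by (simp add: of_nat_diff)
  qed (auto simp: strict_mono_on_def)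
  then have "Determinant.det (Matrix.mat N N (\<lambda>(j, i). path_count (\<lambda>_. UNIV) s (L - r) (int (M + j)) i :: 'a)) \<noteq> 0"
    by (subst det_path_count_eq_path_families[OF s(1)]) (auto simp: strict_mono_on_def)
  also have "Matrix.mat N N (\<lambda>(j, i). path_count (\<lambda>_. UNIV) s (L - r) (int (M + j)) i :: 'a) =
    Matrix.mat N N (\<lambda>(j, i). coeff (?E * monom 1 (nat (s i))) (M + j))"
    using spos by (intro eq_matI) (auto simp: path_count_free icoeff_def nat_add_distrib)
  finally have det: "Determinant.det (Matrix.mat N N (\<lambda>(j, i). coeff (?E * monom 1 (nat (s i))) (M + j))) \<noteq> 0" .
  have nat_inj: "inj_on (\<lambda>i. nat (s i)) {..<N}"
  proof (rule inj_onI)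
    fix i j assume "i \<in> {..<N}" "j \<in> {..<N}" "nat (s i) = nat (s j)"
    then show "i = j"
      using inj_onD[OF strict_mono_on_imp_inj_on[OF s(1)], of i j] spos[of i] spos[of j] by simp
  qed
  have mem: "m \<in> (\<lambda>i. nat (s i)) ` {..<N} \<longleftrightarrow> int m \<in> S" for m
  proof
    assume "m \<in> (\<lambda>i. nat (s i)) ` {..<N}"
    then obtain i where "i < N" "m = nat (s i)" by auto
    then show "int m \<in> S" using spos[of i] s(2) by auto
  next
    assume "int m \<in> S"
    then obtain i where "i < N" "int m = s i" unfolding s(2)[symmetric] by auto
    then show "m \<in> (\<lambda>i. nat (s i)) ` {..<N}" by (intro image_eqI[of _ _ i]) auto
  qed
  have "(\<Sum>i<N. coeff (?E * monom 1 (nat (s i))) (M + j) * coeff H (nat (s i))) = 0" if j: "j < N" for j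
  proof -
    define F where "F m = (if M + j < m then 0 else coeff ?E (M + j - m)) * coeff H m" for m
    have E0: "coeff ?E d = 0" if "L - r < d" for d
    proof (rule coeff_eq_0)
      have "degree ?E \<le> degree [:1, 1 :: 'a:] * (L - r)" by (rule degree_power_le)
      then show "degree ?E < d" using that by simp
    qed
    have "(\<Sum>i<N. coeff (?E * monom 1 (nat (s i))) (M + j) * coeff H (nat (s i))) = (\<Sum>i<N. F (nat (s i)))"
      by (intro sum.cong) (auto simp: F_def mult.commute[of ?E] coeff_monom_mult)
    also have "\<dots> = (\<Sum>m\<in>(\<lambda>i. nat (s i)) ` {..<N}. F m)"
      by (subst sum.reindex[OF nat_inj]) simp
    also have "\<dots> = (\<Sum>m\<le>M + j. F m)"
    proof (rule sum.mono_neutral_cong)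
      show "F m = 0" if "m \<in> {..M + j} - (\<lambda>i. nat (s i)) ` {..<N}" for m
      proof (cases "int m \<in> hexcol L M N (int r)")
        case True
        then show ?thesis using H(1) that mem by (simp add: F_def)
      next
        \<comment> \<open>Places above the hexagon are killed by the vanishing of the high
          coefficients of \<open>H\<close>, places below it by the degree \<open>L - r\<close> of
          \<open>?E\<close>.\<close>
        case False
        then have "r + N \<le> m \<or> L - r < M + j - m"
          using that j \<open>r < L\<close> by (auto simp: hexcol_def)
        then show ?thesis using H(2) E0 by (auto simp: F_def)
      qed
    qed (auto simp: F_def)
    also have "\<dots> = coeff (H * ?E) (M + j)"
      unfolding coeff_mult by (intro sum.cong) (auto simp: F_def)
    also have "\<dots> = 0" using window[OF j] by (simp add: mult.commute)
    finally show ?thesis .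
  qed
  from det_nonzero_kernel[OF det this]
  have "coeff H (nat (s i)) = 0" if "i < N" for i using that by blast
  moreover obtain i where "i < N" "l = nat (s i)" using l mem[of l] by auto
  ultimately show ?thesis by simp
qed

section \<open>The analytic hypotheses in terms of coefficients\<close>

lemma bigo_1_imp_coeff_eq_0:
  fixes P :: "complex poly"
  assumes "(\<lambda>z. poly P z / z ^ n) \<in> O[at 0](\<lambda>_. 1)" "i < n"
  shows "coeff P i = 0"
  using assms
proof (induction n arbitrary: P i)
  case 0
  from 0(2) show ?case by (rule less_zeroE)
next
  case (Suc n)
  obtain a R where P: "P = pCons a R" by (cases P)
  obtain c where c: "eventually (\<lambda>z. norm (poly P z / z ^ Suc n) \<le> c * norm (1 :: complex)) (at 0)"
    using landau_o.bigE[OF Suc.prems(1)] by metis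
  \<comment> \<open>The constant term is the limit at 0, so it vanishes; one factor \<open>z\<close>
    can then be cancelled.\<close>
  have "((\<lambda>z. poly P z) \<longlongrightarrow> 0) (at 0)"
  proof (rule Lim_null_comparison)
    show "eventually (\<lambda>z. norm (poly P z) \<le> c * norm z ^ Suc n) (at 0)"
      using c eventually_neq_at_within[of 0]
    proof eventually_elim
      case (elim z)
      then show ?case by (simp add: norm_divide norm_power norm_mult divide_le_eq)
    qed
    have "((\<lambda>z::complex. c * norm z ^ Suc n) \<longlongrightarrow> c * norm (0::complex) ^ Suc n) (at 0)"
      by (intro tendsto_intros)
    then show "((\<lambda>z::complex. c * norm z ^ Suc n) \<longlongrightarrow> 0) (at 0)" by simp
  qed
  moreover have "((\<lambda>z. poly P z) \<longlongrightarrow> poly P 0) (at 0)"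
    by (intro tendsto_intros)
  ultimately have "0 = poly P 0" by (rule tendsto_unique[OF at_neq_bot])
  then have a: "a = 0" by (simp add: P)
  have "eventually (\<lambda>z. poly P z / z ^ Suc n = poly R z / z ^ n) (at 0)"
    using eventually_neq_at_within[of 0] by eventually_elim (simp add: P a)
  from landau_o.big.in_cong[OF this] have "(\<lambda>z. poly R z / z ^ n) \<in> O[at 0](\<lambda>_. 1)"
    using Suc.prems(1) by simp
  then show ?case using Suc.IH[of R] Suc.prems(2) by (cases i) (auto simp: P a)
qed

lemma higher_deriv_poly: "(deriv ^^ n) (poly p) = poly ((pderiv ^^ n) p)"
proof (induction n)
  case (Suc n)
  have "deriv (poly q) = poly (pderiv q)" for q :: "'a poly"
    by (rule ext) (rule DERIV_imp_deriv, rule poly_DERIV)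
  then show ?case using Suc by simp
qed simp

lemma higher_deriv_poly_0:
  fixes p :: "'a::real_normed_field poly"
  shows "(deriv ^^ n) (poly p) 0 / fact n = coeff p n"
proof -
  have "(deriv ^^ n) (poly p) 0 = coeff ((pderiv ^^ n) p) 0"
    by (simp add: higher_deriv_poly poly_0_coeff_0)
  also have "\<dots> = fact n * coeff p n"
    by (simp add: coeff_higher_pderiv pochhammer_fact)
  finally show ?thesis by simp
qed

lemma coeff_poly_slice: "coeff (poly_slice P a b) l = (if a \<le> l \<and> l \<le> b then coeff P l else 0)"
proof -
  have "coeff (poly_slice P a b) l = (\<Sum>i=a..b. if i = l then coeff P l else 0)"
    unfolding poly_slice_def coeff_sum by (intro sum.cong) auto
  then show ?thesis by simp
qed

lemma interval_chain:
  fixes k :: "nat \<Rightarrow> int"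
  assumes odd: "\<And>j. j \<le> q \<Longrightarrow> k (2 * j + 1) \<le> k (2 * j)"
    and even: "\<And>j. j < q \<Longrightarrow> k (2 * j + 2) < k (2 * j + 1)"
    and "i \<le> j" "j \<le> q"
  shows "k (2 * j) \<le> k (2 * i)" "k (2 * j + 1) \<le> k (2 * i + 1)" "i < j \<Longrightarrow> k (2 * j) < k (2 * i + 1)"
proof -
  have "k (2 * j) \<le> k (2 * i) \<and> k (2 * j + 1) \<le> k (2 * i + 1) \<and> (i < j \<longrightarrow> k (2 * j) < k (2 * i + 1))"
    using assms(3,4)
  proof (induction j rule: dec_induct)
    case (step n)
    then show ?case using even[of n] odd[of n] odd[of "Suc n"] by (auto simp: numeral_2_eq_2)
  qed simp
  then show "k (2 * j) \<le> k (2 * i)" "k (2 * j + 1) \<le> k (2 * i + 1)" "i < j \<Longrightarrow> k (2 * j) < k (2 * i + 1)"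
    by auto
qed

text \<open>The intervals are disjoint, so no coefficient is taken twice. Nonnegativity matters
  because \<open>nat\<close> would move negative bounds to 0.\<close>

lemma sum_poly_slice:
  assumes odd: "\<And>j. j \<le> q \<Longrightarrow> k (2 * j + 1) \<le> k (2 * j)"
    and even: "\<And>j. j < q \<Longrightarrow> k (2 * j + 2) < k (2 * j + 1)"
    and nonneg: "0 \<le> k (2 * q + 1)"
  shows "(\<Sum>j=0..q. poly_slice P (nat (k (2 * j + 1))) (nat (k (2 * j)))) = P - avoid (holecol r q k (int r)) P"
proof (rule poly_eqI)
  fix l
  define J where "J = {j \<in> {0..q}. k (2 * j + 1) \<le> int l \<and> int l \<le> k (2 * j)}"
  have chain: "k (2 * j + 1) \<le> k (2 * i + 1)" "i < j \<Longrightarrow> k (2 * j) < k (2 * i + 1)" if "i \<le> j" "j \<le> q" for i j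
    using interval_chain(2,3)[of q k i j] odd even that by blast+
  have pos: "0 \<le> k (2 * j)" if "j \<le> q" for j
    using chain(1)[OF that order_refl] odd[OF that] nonneg by linarith
  have "coeff (\<Sum>j=0..q. poly_slice P (nat (k (2 * j + 1))) (nat (k (2 * j)))) l =
    (\<Sum>j=0..q. if k (2 * j + 1) \<le> int l \<and> int l \<le> k (2 * j) then coeff P l else 0)"
    unfolding coeff_sum coeff_poly_slice
    using pos by (intro sum.cong refl if_cong) (auto simp: nat_le_iff le_nat_iff)
  also have "\<dots> = (\<Sum>j\<in>J. coeff P l)"
    unfolding J_def by (intro sum.inter_filter[symmetric]) simp
  also have "\<dots> = (if J = {} then 0 else coeff P l)"
  proof (cases "J = {}")
    case False
    then obtain j where j: "j \<in> J" by blast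
    have "j' = j" if "j' \<in> J" for j'
      using chain(2)[of j j'] chain(2)[of j' j] j that by (cases j j' rule: linorder_cases) (auto simp: J_def)
    then have "J = {j}" using j by blast
    then show ?thesis by simp
  qed simp
  also have "J = {} \<longleftrightarrow> int l \<notin> holecol r q k (int r)"
    by (auto simp: J_def holecol_def)
  finally show "coeff (\<Sum>j=0..q. poly_slice P (nat (k (2 * j + 1))) (nat (k (2 * j)))) l =
    coeff (P - avoid (holecol r q k (int r)) P) l"
    by (simp add: coeff_avoid)
qed

theorem theorem6p1:
  fixes L M N r q :: nat and k :: "nat \<Rightarrow> int" and Q p :: "complex poly"
  assumes "0 < L" and "0 < M" and "0 < N" and "M < L" and "r \<in> {1..L - 1}"
    and "\<And>j. j \<le> q \<Longrightarrow> k (2 * j + 1) \<le> k (2 * j)"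
    and "\<And>j. j < q \<Longrightarrow> k (2 * j + 2) < k (2 * j + 1)"
    and "k 0 + 2 - k 1 + (\<Sum>j=1..q. k (2 * j) + 1 - k (2 * j + 1))
           \<le> Min {int r, int M, int L - int r}"
    and "max 0 (int r - int L + int M) \<le> k (2 * q + 1)"
    and "k (2 * q + 1) \<le> k 0 + 1"
    and "k 0 + 1 \<le> min (int M + int N - 1) (int r + int N - 1)"
    and "degree Q \<le> M - 1" and "degree p \<le> N - 1"
    and "(\<lambda>z. poly Q z / z ^ (M + N) + (1 + z) ^ L / z ^ (M + N) * poly p z
            - (1 + z) ^ (L - r) / z ^ (M + N)
              * (z ^ nat (k 0 + 1)
                 + (\<Sum>j=0..q. poly (poly_slice ([:1, 1:] ^ r * p)
                                    (nat (k (2 * j + 1))) (nat (k (2 * j)))) z)))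
           \<in> O[at 0](\<lambda>_. 1)"
  shows "of_nat (G L M N r q (k(0 := k 0 + 1))) / of_nat (G L M N r q k)
           = 1 - (deriv ^^ nat (k 0 + 1)) (\<lambda>z. (1 + z) ^ r * poly p z) 0 / fact (nat (k 0 + 1))"
proof -
  note odd = assms(6) and even = assms(7)
  let ?k = "k(0 := k 0 + 1)"
  have r: "1 \<le> r" "r < L" using assms(5) by auto
  define \<kappa> where "\<kappa> = nat (k 0 + 1)"
  define I where "I = holecol r q k (int r)"
  define B :: "complex poly" where "B = [:1, 1:]"
  define E where "E = B ^ (L - r)"
  define P where "P = B ^ r * p"
  have chain: "k (2 * j) \<le> k (2 * i)" "k (2 * j + 1) \<le> k (2 * i + 1)" if "i \<le> j" "j \<le> q" for i j
    using interval_chain(1,2)[of q k i j] odd even that by blast+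
  have k0: "k (2 * j) \<le> k 0" and klow: "k (2 * q + 1) \<le> k (2 * j + 1)" if "j \<le> q" for j
    using chain(1)[of 0 j] chain(2)[of j q] that by auto
  have nonneg: "0 \<le> k (2 * q + 1)" using assms(9) by simp
  have \<kappa>: "int \<kappa> = k 0 + 1" using nonneg assms(10) by (simp add: \<kappa>_def)
  have I_eq: "I = (\<Union>j\<in>{0..q}. {k (2 * j + 1)..k (2 * j)})"
    by (auto simp: I_def holecol_def)
  have I'_eq: "holecol r q ?k (int r) = insert (int \<kappa>) I"
  proof -
    have split: "{0..q} = insert 0 {1..q}" by auto
    have "holecol r q ?k (int r) = (\<Union>j\<in>{0..q}. {k (2 * j + 1)..?k (2 * j)})"
      by (auto simp: holecol_def)
    also have "\<dots> = {k 1..k 0 + 1} \<union> (\<Union>j\<in>{1..q}. {k (2 * j + 1)..k (2 * j)})"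
      unfolding split by simp
    also have "{k 1..k 0 + 1} = insert (int \<kappa>) {k 1..k 0}" using odd[of 0] \<kappa> by auto
    also have "insert (int \<kappa>) {k 1..k 0} \<union> (\<Union>j\<in>{1..q}. {k (2 * j + 1)..k (2 * j)}) = insert (int \<kappa>) I"
      unfolding I_eq split by simp
    finally show ?thesis .
  qed
  have \<kappa>I: "int \<kappa> \<notin> I" using k0 \<kappa> by (fastforce simp: I_eq)
  have \<kappa>hex: "int \<kappa> \<in> hexcol L M N (int r)"
    using assms(9-11) \<kappa> by (auto simp: hexcol_def)
  \<comment> \<open>All summands of the size hypothesis are nonnegative, so each interval obeys the
    bound by itself; \<open>k 0 + 2 - k 1\<close> is the number of places in the enlarged first
    interval.\<close>
  have size': "?k (2 * j) - ?k (2 * j + 1) < min (int r) (int L - int r)" if "j \<le> q" for j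
  proof -
    have pos: "0 \<le> k (2 * j) + 1 - k (2 * j + 1)" if "j \<in> {1..q}" for j
      using odd[of j] that by auto
    have "k 0 + 2 - k 1 + (\<Sum>j=1..q. k (2 * j) + 1 - k (2 * j + 1)) \<le> min (int r) (int L - int r)"
      using assms(8) by auto
    moreover have "0 \<le> (\<Sum>j=1..q. k (2 * j) + 1 - k (2 * j + 1))" by (rule sum_nonneg) (rule pos)
    moreover have "k (2 * j) + 1 - k (2 * j + 1) \<le> (\<Sum>j=1..q. k (2 * j) + 1 - k (2 * j + 1))" if "j \<noteq> 0"
      using that \<open>j \<le> q\<close> pos by (intro member_le_sum) auto
    moreover have "k 1 \<le> k 0" using odd[of 0] by simp
    ultimately show ?thesis by (cases "j = 0") auto
  qed
  have size: "k (2 * j) - k (2 * j + 1) < min (int r) (int L - int r)" if "j \<le> q" for j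
    using size'[OF that] by (auto split: if_splits)
  have odd': "?k (2 * j + 1) \<le> ?k (2 * j)" if "j \<le> q" for j
    using odd[OF that] by auto
  define A where "A j i = coeff (E * avoid I (B ^ r * monom 1 i)) (M + j)" for j i
  \<comment> \<open>\<open>u j\<close> counts the paths from the new hole to
    \<open>(L, M + j)\<close> and \<open>v i\<close> those from \<open>(0, i)\<close> to the new
    hole, so \<open>u j * v i\<close> counts what the new hole destroys.\<close>
  define u where "u j = coeff (E * monom 1 \<kappa>) (M + j)" for j
  define v where "v i = coeff (B ^ r * monom 1 i) \<kappa>" for i
  have G: "of_nat (G L M N r q k) = Determinant.det (Matrix.mat N N (\<lambda>(j, i). A j i))"
    unfolding A_def E_def B_def I_def using assms(2-4) r odd size by (intro G_eq_det(1))
  have A': "coeff (E * avoid (holecol r q ?k (int r)) (B ^ r * monom 1 i)) (M + j) = A j i - u j * v i" for i j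
  proof -
    have "avoid (holecol r q ?k (int r)) (B ^ r * monom 1 i) =
      avoid I (B ^ r * monom 1 i) - Polynomial.smult (v i) (monom 1 \<kappa>)"
      unfolding I'_eq using \<kappa>I by (intro poly_eqI) (auto simp: coeff_avoid v_def)
    then show ?thesis by (simp add: A_def u_def right_diff_distrib mult.commute)
  qed
  have G': "of_nat (G L M N r q ?k) = Determinant.det (Matrix.mat N N (\<lambda>(j, i). A j i - u j * v i))"
    unfolding A'[symmetric] E_def B_def using assms(2-4) r odd' size' by (intro G_eq_det(1))

  have p_sum: "p = (\<Sum>i<N. Polynomial.smult (coeff p i) (monom 1 i))"
  proof (rule poly_eqI)
    fix l
    have "coeff (\<Sum>i<N. Polynomial.smult (coeff p i) (monom 1 i)) l = (\<Sum>i<N. if i = l then coeff p l else 0)"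
      unfolding coeff_sum by (intro sum.cong) auto
    then show "coeff p l = coeff (\<Sum>i<N. Polynomial.smult (coeff p i) (monom 1 i)) l"
      using assms(3,13) by (auto simp: coeff_eq_0)
  qed
  have P_sum: "P = (\<Sum>i<N. Polynomial.smult (coeff p i) (B ^ r * monom 1 i))"
    unfolding P_def by (subst p_sum) (simp add: sum_distrib_left)
  have window: "coeff (E * avoid I P) (M + j) = u j" if j: "j < N" for j
  proof -
    \<comment> \<open>The numerator of the \<open>O(1)\<close> condition: its coefficients below
      \<open>M + N\<close> vanish, and from \<open>M\<close> on \<open>Q\<close> does not contribute
      to them.\<close>
    define R where "R = Q + B ^ L * p - E * (monom 1 \<kappa> + (P - avoid I P))"
    have "(\<lambda>z. poly R z / z ^ (M + N)) \<in> O[at 0](\<lambda>_. 1)"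
    proof -
      have slices: "(\<Sum>j=0..q. poly_slice P (nat (k (2 * j + 1))) (nat (k (2 * j)))) = P - avoid I P"
        unfolding I_def using odd even nonneg by (rule sum_poly_slice)
      have "poly (P - avoid I P) z = (\<Sum>j=0..q. poly (poly_slice ([:1, 1:] ^ r * p)
          (nat (k (2 * j + 1))) (nat (k (2 * j)))) z)" for z
        unfolding slices[symmetric] poly_sum unfolding P_def B_def ..
      then have "poly R z / z ^ (M + N) = poly Q z / z ^ (M + N) + (1 + z) ^ L / z ^ (M + N) * poly p z
            - (1 + z) ^ (L - r) / z ^ (M + N)
              * (z ^ nat (k 0 + 1)
                 + (\<Sum>j=0..q. poly (poly_slice ([:1, 1:] ^ r * p)
                                    (nat (k (2 * j + 1))) (nat (k (2 * j)))) z))" for z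
        unfolding R_def by (simp add: E_def B_def \<kappa>_def poly_monom add_divide_distrib diff_divide_distrib)
      then show ?thesis using assms(14) by simp
    qed
    from bigo_1_imp_coeff_eq_0[OF this, of "M + j"] have "coeff R (M + j) = 0" using j by simp
    moreover have "coeff Q (M + j) = 0" using assms(2,12) by (intro coeff_eq_0) simp
    moreover have "B ^ L * p = E * P"
      using r by (simp add: E_def P_def mult.assoc[symmetric] power_add[symmetric])
    then have "R = Q + E * avoid I P - E * monom 1 \<kappa>" by (simp add: R_def algebra_simps)
    ultimately show ?thesis by (simp add: u_def)
  qed
  have kernel: "(\<Sum>i<N. A j i * coeff p i) = u j" if "j < N" for j
    unfolding window[OF that, symmetric]
    by (subst P_sum) (simp add: A_def avoid_sum avoid_smult sum_distrib_left coeff_sum mult.commute)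
  have alpha: "(\<Sum>i<N. coeff p i * v i) = coeff P \<kappa>"
    by (subst P_sum) (simp add: v_def coeff_sum)
  have ratio: "of_nat (G L M N r q ?k) = of_nat (G L M N r q k) * (1 - coeff P \<kappa>)"
    unfolding G G' alpha[symmetric] by (rule det_rank_one_update) (rule kernel)
  have "(\<lambda>z. (1 + z) ^ r * poly p z) = poly P"
    by (rule ext) (simp add: P_def B_def)
  then have deriv: "(deriv ^^ nat (k 0 + 1)) (\<lambda>z. (1 + z) ^ r * poly p z) 0 / fact (nat (k 0 + 1)) = coeff P \<kappa>"
    by (simp add: higher_deriv_poly_0 \<kappa>_def)
  let ?C = "hexcol L M N (int r) - I"
  show ?thesis
  proof (cases "N \<le> card ?C")
    case True
    then obtain S where S: "S \<subseteq> ?C" "card S = N" "finite S"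
      using obtain_subset_with_card_n[OF True] by metis
    obtain s where s: "strict_mono_on {0..<N} s" "s ` {0..<N} = S"
      using strict_mono_enumeration[OF S(3,2)] by metis
    have "0 < path_families N (\<lambda>a. if a = int r then - I else UNIV) int L (\<lambda>j. int (M + j))"
      using path_families_through_pos[OF s(1) _ r(2), of M I] s(2) S(1) by auto
    moreover have "(of_nat (G L M N r q k) :: complex) =
      of_nat (path_families N (\<lambda>a. if a = int r then - I else UNIV) int L (\<lambda>j. int (M + j)))"
      unfolding I_def using assms(2-4) r odd size by (intro G_eq_det(2))
    ultimately have "(of_nat (G L M N r q k) :: complex) \<noteq> 0" by simp
    then show ?thesis unfolding deriv ratio by simp
  next
    \<comment> \<open>\<open>S\<close> will consist of all free places of column \<open>r\<close>,
      padded with hole places up to \<open>N\<close> elements. At the places left over, which are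
      holes, both \<open>avoid I P\<close> and the monomial vanish.\<close>
    case False
    have "N \<le> card (hexcol L M N (int r))"
    proof -
      let ?c = "max 0 (int r - int L + int M)"
      have "card {?c..<?c + int N} \<le> card (hexcol L M N (int r))"
        using r assms(4) by (intro card_mono) (auto simp: hexcol_def)
      then show ?thesis by simp
    qed
    then obtain S where S: "?C \<subseteq> S" "S \<subseteq> hexcol L M N (int r)" "card S = N"
      using exists_subset_between[of ?C N "hexcol L M N (int r)"] False by auto
    have "coeff (avoid I P - monom 1 \<kappa>) \<kappa> = 0"
    proof (rule coeff_zero_of_window_zero[OF assms(2,4,3) r(2) S(2,3)])
      show "coeff (avoid I P - monom 1 \<kappa>) l = 0" if "int l \<in> hexcol L M N (int r)" "int l \<notin> S" for l
        using that S(1) \<kappa>I \<kappa>hex by (auto simp: coeff_avoid)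
      show "coeff (avoid I P - monom 1 \<kappa>) l = 0" if "r + N \<le> l" for l
      proof -
        have "degree P \<le> degree (B ^ r) + degree p" unfolding P_def by (rule degree_mult_le)
        also have "degree (B ^ r) \<le> degree B * r" by (rule degree_power_le)
        finally have "coeff P l = 0" using that assms(3,13) by (intro coeff_eq_0) (simp add: B_def)
        moreover have "\<kappa> \<noteq> l" using that \<kappa>hex by (auto simp: hexcol_def)
        ultimately show ?thesis by (simp add: coeff_avoid)
      qed
      show "coeff ([:1, 1:] ^ (L - r) * (avoid I P - monom 1 \<kappa>)) (M + j) = 0" if "j < N" for j
        using window[OF that] by (simp add: u_def E_def B_def right_diff_distrib)
      show "int \<kappa> \<in> S" using S(1) \<kappa>I \<kappa>hex by blast
    qed
    \<comment> \<open>The numerator of the quotient carries the factor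
      \<open>1 - coeff P \<kappa>\<close>, so both sides of the claim are 0, whatever the
      denominator.\<close>
    then have "coeff P \<kappa> = 1" using \<kappa>I by (simp add: coeff_avoid)
    then show ?thesis unfolding deriv ratio by simp
  qed
qed

end
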